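(* Let $\ell\ge2$ be an integer, $\ell_{\mathsf c}=\ell(\ell+1)/2$, and consider first-passage percolation on the $\ell$-spread-out line with i.i.d. nonnegative edge weights distributed as $\omega$. Assume that $\bar F(x):=\mathbb P(\omega>x)=x^{-\gamma}L(x)$ as $x\to\infty$ for some $\gamma\in(0,2)$ and some slowly varying function $L$. Let $\rho_1<\rho_2$ be the first two pivots in $[0,\infty)$. Then $$\bar F(x)^{-\ell_{\mathsf c}}\;\mathbb P\bigl(T(\rho_1,\rho_2)>x\bigr)\longrightarrow \mathbb E(\rho_2-\rho_1)\qquad\text{as }x\to\infty.$$
   Context: The $\ell$-spread-out line is the undirected graph on $\mathbb Z$ with edge set $\{(x,y):x,y\in\mathbb Z,\ 1\le y-x\le\ell\}$. Edges carry i.i.d. nonnegative weights $\omega_{x,y}=\omega_{y,x}$ with the law of $\omega$. The passage time $T(u,v)$ is the minimal total weight of a path from $u$ to $v$. Fix $a>0$ with $\mathbb P(\omega>2a)>0$ and $\mathbb P(\omega<a)>0$ (such $a$ exists because $\omega$ has unbounded support). A vertex $v$ is called a pivot if $\omega_{x,v}<a$, $\omega_{v,y}<a$ and $\omega_{x,y}>2a$ for all $x<v<y$ with $2\le y-x\le \ell$. Almost surely there are infinitely many pivots in $[0,\infty)$, denoted $0\le\rho_1<\rho_2<\cdots$. *)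

theory Defs
  imports
    "HOL-Probability.Probability"
    "HOL-Library.Infinite_Set"
    "Graph_Theory.Pair_Digraph"
begin

definition edges :: "nat \<Rightarrow> (int \<times> int) set" where
  "edges l = {(x, y). 1 \<le> y - x \<and> y - x \<le> int l}"

text \<open>
  The undirected graph, represented by the symmetric digraph in which every edge is
  present in both orientations.
\<close>
definition spread_out_line :: "nat \<Rightarrow> int pair_pre_digraph" where
  "spread_out_line l = \<lparr> pverts = UNIV, parcs = edges l \<union> (edges l)\<inverse> \<rparr>"

text \<open>
  A weight configuration is given by its values on \<^term>\<open>edges l\<close>; the weight of an
  arc does not depend on its orientation.
\<close>
definition arc_weight :: "(int \<times> int \<Rightarrow> real) \<Rightarrow> int \<times> int \<Rightarrow> real" where
  "arc_weight w e = w (min (fst e) (snd e), max (fst e) (snd e))"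

text \<open>
  The minimal total weight, read as an infimum since there are infinitely many paths
  from \<^term>\<open>u\<close> to \<^term>\<open>v\<close>.
\<close>
definition passage_time :: "nat \<Rightarrow> (int \<times> int \<Rightarrow> real) \<Rightarrow> int \<Rightarrow> int \<Rightarrow> ereal" where
  "passage_time l w u v =
     (INF p \<in> {p. pre_digraph.apath (with_proj (spread_out_line l)) u p v}.
        ereal (sum_list (map (arc_weight w) p)))"

definition pivot :: "nat \<Rightarrow> real \<Rightarrow> (int \<times> int \<Rightarrow> real) \<Rightarrow> int \<Rightarrow> bool" where
  "pivot l a w v \<longleftrightarrow>
     (\<forall>x y. x < v \<and> v < y \<and> 2 \<le> y - x \<and> y - x \<le> int l \<longrightarrow>
        w (x, v) < a \<and> w (v, y) < a \<and> w (x, y) > 2 * a)"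

text \<open>
  The \<^term>\<open>k\<close>-th pivot in $[0,\infty)$, counted from \<^term>\<open>k = 1\<close>. It is meaningful
  when there are infinitely many pivots there, which holds almost surely.
\<close>
definition rho :: "nat \<Rightarrow> real \<Rightarrow> (int \<times> int \<Rightarrow> real) \<Rightarrow> nat \<Rightarrow> int" where
  "rho l a w k = int (enumerate {n. pivot l a w (int n)} (k - 1))"

definition survival :: "real measure \<Rightarrow> real \<Rightarrow> real" where
  "survival D x = measure D {x<..}"

definition slowly_varying :: "(real \<Rightarrow> real) \<Rightarrow> bool" where
  "slowly_varying L \<longleftrightarrow>
     (\<exists>X. (\<forall>x\<ge>X. 0 < L x) \<and> L \<in> borel_measurable (restrict_space borel {X..})) \<and>
     (\<forall>t>0. ((\<lambda>x. L (t * x) / L x) \<longlongrightarrow> 1) at_top)"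

end

theory Submission
  imports Defs "HOL-Real_Asymp.Real_Asymp"
begin

text \<open>
  Jumping over a pivot costs more than passing through it, so a large passage time
  $T(\rho_1,\rho_2)$ forces a cut separating $\rho_1$ from $\rho_2$ inside $[\rho_1,\rho_2]$ all
  of whose edges are heavy. For each $d\le\ell$, such a cut contains an edge of length $d$ in
  every residue class modulo $d$, hence at least $\ell_{\mathsf c}$ edges, with equality only for the
  straight cut between some $k$ and $k+1$. Heaviness of the cut at $k$ excludes pivots in
  $(k-\ell+1,k]$, and it is independent of the event that $[0,k-\ell+1]$ contains exactly one
  pivot; summing the probabilities of the latter events over $k$ gives $\mathbb E(\rho_2-\rho_1)$.
  The heavy tail is used twice: the edges outside the cut can be taken of order below
  $\varepsilon x$, since one more heavy edge costs a further factor $\bar F(x)$, and a polynomial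
  bound on $\bar F(x/m)/\bar F(x)$ is beaten by the exponential decay in $m$ of the
  probability that $\rho_2=m$, even when some edges are prescribed to be heavy.
\<close>

section \<open>Paths and cuts of the spread-out line\<close>

text \<open>A heavy cut between k and k + 1 distorts the pivots around it, so the pair (rho_1,
  rho_2) is not conditioned on. With m = k - l + 1, only the pivots in [0, m] are inspected; that
  rho_2 lies beyond k is then forced by heaviness itself. For x \<ge> a, a heavy cut in this
  position therefore has probability exactly P(rho_1 \<le> m < rho_2) times a power of the tail.
  This is why the full gap rho_2 - rho_1 appears in the limit, although only rho_2 - rho_1 - l + 1
  such cuts fit between two given pivots.

  The upper bound works with two thresholds: x = z + n y, where z is nearly x and is what the cut
  must exceed, and n y pays for all other edges as long as rho_2 \<le> n. Since n is fixed before x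
  grows, the case rho_2 > n needs a bound uniform in x. There the threshold is x / m with m = rho_2;
  it falls below a for large m, where the light edges at the pivots are no longer below it, and the
  estimate has to cover this regime too.\<close>

definition cut_edges :: "nat \<Rightarrow> int \<Rightarrow> (int \<times> int) set" where
  "cut_edges l k = {(x, y) \<in> edges l. x \<le> k \<and> k < y}"

abbreviation lattice_path :: "nat \<Rightarrow> int \<Rightarrow> (int \<times> int) list \<Rightarrow> int \<Rightarrow> bool" where
  "lattice_path l \<equiv> pre_digraph.apath (with_proj (spread_out_line l))"

lemma lattice_path_arcs: "lattice_path l u p v \<Longrightarrow> set p \<subseteq> edges l \<union> (edges l)\<inverse>"
  by (auto simp: pre_digraph.apath_def pre_digraph.awalk_def spread_out_line_def)

lemma arc_weight_edges:
  assumes "e \<in> edges l \<union> (edges l)\<inverse>"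
  obtains e' where "e' \<in> edges l" "\<And>w. arc_weight w e = w e'"
  using assms by (auto simp: arc_weight_def edges_def)

lemma lattice_path_crosses:
  assumes "lattice_path l u p v" "u \<le> k" "k < v"
  shows "\<exists>e\<in>set p. \<exists>e'\<in>cut_edges l k. \<forall>w. arc_weight w e = w e'"
proof -
  have "pcas u p v" and arcs: "set p \<subseteq> edges l \<union> (edges l)\<inverse>"
    using assms lattice_path_arcs[OF assms(1)]
    by (auto simp: pre_digraph.apath_def pre_digraph.awalk_def cas_with_proj_eq)
  then have "\<exists>e\<in>set p. fst e \<le> k \<and> k < snd e"
    using assms(2,3)
  proof (induction p arbitrary: u)
    case (Cons e p)
    show ?case
    proof (cases "snd e \<le> k")
      case True
      then show ?thesis using Cons.IH[of "snd e"] Cons.prems by auto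
    qed (use Cons.prems in auto)
  qed auto
  then obtain e where e: "e \<in> set p" "fst e \<le> k" "k < snd e" by blast
  with arcs have "e \<in> cut_edges l k"
    by (auto simp: cut_edges_def edges_def)
  with e show ?thesis
    by (intro bexI[of _ e]) (auto simp: arc_weight_def)
qed

lemma finite_edges_between: "finite (edges l \<inter> {u..v} \<times> {u..v})"
  by (intro finite_Int) auto

lemma cut_between: "cut_edges l k \<subseteq> edges l \<inter> {k + 1 - int l..k + int l} \<times> {k + 1 - int l..k + int l}"
  by (auto simp: cut_edges_def edges_def)

lemma finite_cut: "finite (cut_edges l k)"
  using finite_subset[OF cut_between finite_edges_between] .

text \<open>An infimum over infinitely many paths need not keep a strict bound. The minimum over the
  finite cut still exceeds \<open>x\<close>, and every path pays at least this minimum for its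
  crossing, the other arcs being nonnegative.\<close>

lemma passage_time_gt:
  assumes "l \<ge> 1" and nonneg: "\<And>e. e \<in> edges l \<Longrightarrow> 0 \<le> w e"
    and "\<And>e. e \<in> cut_edges l k \<Longrightarrow> x < w e" and "u \<le> k" "k < v"
  shows "ereal x < passage_time l w u v"
proof -
  have "(k, k + 1) \<in> cut_edges l k" using \<open>l \<ge> 1\<close> by (auto simp: cut_edges_def edges_def)
  then have ne: "cut_edges l k \<noteq> {}" by blast
  define m where "m = Min (w ` cut_edges l k)"
  have "x < m" unfolding m_def using assms(3) ne finite_cut by (subst Min_gr_iff) auto
  moreover have "ereal m \<le> passage_time l w u v"
    unfolding passage_time_def
  proof (rule INF_greatest)
    fix p assume "p \<in> {p. lattice_path l u p v}"
    then have p: "lattice_path l u p v" by simp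
    obtain e e' where e: "e \<in> set p" "e' \<in> cut_edges l k" "arc_weight w e = w e'"
      using lattice_path_crosses[OF p assms(4,5)] by metis
    have "m \<le> arc_weight w e" unfolding m_def e(3) using e finite_cut by auto
    also have "\<dots> \<le> sum_list (map (arc_weight w) p)"
    proof (rule member_le_sum_list)
      show "arc_weight w e \<in> set (map (arc_weight w) p)" using e(1) by simp
      fix z assume "z \<in> set (map (arc_weight w) p)"
      then obtain f where f: "f \<in> set p" "z = arc_weight w f" by auto
      then have "f \<in> edges l \<union> (edges l)\<inverse>" using lattice_path_arcs[OF p] by auto
      then show "0 \<le> z" using nonneg f(2) by (metis arc_weight_edges)
    qed
    finally show "ereal m \<le> ereal (sum_list (map (arc_weight w) p))" by simp
  qed
  ultimately show ?thesis by (metis less_ereal.simps(1) order_less_le_trans)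
qed

text \<open>In the finite graph on \<open>{u..v}\<close> with arcs \<open>A\<close>, reachability
  yields a simple path. It visits each of the v - u + 1 vertices at most once, which bounds its
  length irrespective of the weights.\<close>

lemma lattice_path_within:
  assumes "(u, v) \<in> A\<^sup>*" and A: "A \<subseteq> {u..v} \<times> {u..v}" "A \<subseteq> edges l \<union> (edges l)\<inverse>" and "u \<le> v"
  obtains p where "lattice_path l u p v" "set p \<subseteq> A" "distinct p" "length p \<le> nat (v - u)"
proof -
  define H where "H = \<lparr>pverts = {u..v}, parcs = A\<rparr>"
  have fA: "finite A" using A(1) by (rule finite_subset) simp
  interpret pair_fin_digraph H
    by unfold_locales (use A fA in \<open>auto simp: H_def\<close>)
  have "(u, z) \<in> A\<^sup>* \<Longrightarrow> reachable (with_proj H) u z" for z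
  proof (induction rule: rtrancl_induct)
    case base
    then show ?case using \<open>u \<le> v\<close> by (intro reachable_refl) (simp add: H_def)
  next
    case (step y z)
    then show ?case by (intro reachable_adj_trans[of u y z]) (simp_all add: H_def)
  qed
  with assms(1) obtain p where p: "apath u p v"
    using reachable_apath by blast
  have dist: "distinct (pawalk_verts u p)" and pA: "set p \<subseteq> A" and cas: "pcas u p v"
    using p[unfolded apath_def awalk_def] by (auto simp: H_def)
  show thesis
  proof
    show "set p \<subseteq> A" by fact
    show "distinct p" using dist
      by (induction p arbitrary: u) (auto simp: awalk_verts_conv distinct_map)
    have "length p < card {u..v}"
      using length_apath_less[OF p] by (simp add: H_def)
    then show "length p \<le> nat (v - u)" by auto
    show "lattice_path l u p v"
      using pA A(2) dist cas
      by (auto simp: pre_digraph.apath_def pre_digraph.awalk_def cas_with_proj_eq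
        awalk_verts_with_proj_eq spread_out_line_def)
  qed
qed

text \<open>The arc \<open>f\<close> has its own bound \<open>z\<close> so that a path may use one
  edge of a cut; a simple path pays for it only once.\<close>

lemma passage_time_le:
  assumes "(u, v) \<in> A\<^sup>*" and A: "A \<subseteq> {u..v} \<times> {u..v}" "A \<subseteq> edges l \<union> (edges l)\<inverse>" and "u \<le> v"
    and "0 \<le> y" "0 \<le> z" and light: "\<And>e. e \<in> A \<Longrightarrow> e \<noteq> f \<Longrightarrow> arc_weight w e \<le> y"
    and f: "f \<in> A \<Longrightarrow> arc_weight w f \<le> z"
  shows "passage_time l w u v \<le> ereal (z + real_of_int (v - u) * y)"
proof -
  obtain p where p: "lattice_path l u p v" "set p \<subseteq> A" "distinct p" "length p \<le> nat (v - u)"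
    using lattice_path_within[OF assms(1-4)] .
  have "passage_time l w u v \<le> ereal (sum_list (map (arc_weight w) p))"
    unfolding passage_time_def using p(1) by (intro INF_lower) simp
  moreover have "sum_list (map (arc_weight w) p) = sum (arc_weight w) (set p)"
    using p(3) by (simp add: sum_list_distinct_conv_sum_set)
  also have "\<dots> \<le> (\<Sum>e\<in>set p. y + (if e = f then z else 0))"
    using light f p(2) assms(5,6) by (intro sum_mono) (auto simp: subset_iff)
  also have "\<dots> = real (length p) * y + (if f \<in> set p then z else 0)"
    using distinct_card[OF p(3)] by (simp add: sum.distrib)
  also have "\<dots> \<le> real_of_int (v - u) * y + z"
    using p(4) assms by (intro add_mono mult_right_mono) auto
  ultimately show ?thesis
    by (metis (no_types) add.commute ereal_less_eq(3) order_trans)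
qed

section \<open>Counting the edges that leave a set of vertices\<close>

lemma exists_crossing_step:
  fixes R :: "int set"
  assumes "\<forall>z\<le>A. z \<in> R" and "\<forall>z\<ge>B. z \<notin> R" and "1 \<le> d" and "0 \<le> r" "r < d"
  shows "\<exists>x. x mod d = r \<and> x \<in> R \<and> x + d \<notin> R"
proof (rule ccontr)
  assume "\<not> ?thesis"
  then have step: "x + d \<in> R" if "x mod d = r" "x \<in> R" for x using that by blast
  \<comment> \<open>A point of the residue class of \<open>r\<close> to the left of
    \<open>A\<close>. Steps of length \<open>d\<close> that never leave \<open>R\<close> would lead
    from there beyond \<open>B\<close>.\<close>
  define x0 where "x0 = r + d * (- (\<bar>A\<bar> + r))"
  have "1 * (\<bar>A\<bar> + r) \<le> d * (\<bar>A\<bar> + r)" using assms by (intro mult_right_mono) auto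
  then have "x0 \<le> A" unfolding x0_def by (simp add: algebra_simps)
  have "x0 + d * int n \<in> R \<and> (x0 + d * int n) mod d = r" for n
  proof (induction n)
    case 0
    show ?case using assms \<open>x0 \<le> A\<close> unfolding x0_def by simp
  next
    case (Suc n)
    have "x0 + d * int (Suc n) = (x0 + d * int n) + d" by (simp add: algebra_simps)
    then show ?case using step[of "x0 + d * int n"] Suc by (metis mod_add_self2)
  qed
  then have "x0 + d * int (nat (\<bar>x0\<bar> + \<bar>B\<bar>)) \<in> R" by blast
  moreover have "1 * (\<bar>x0\<bar> + \<bar>B\<bar>) \<le> d * (\<bar>x0\<bar> + \<bar>B\<bar>)" using assms by (intro mult_right_mono) auto
  then have "B \<le> x0 + d * int (nat (\<bar>x0\<bar> + \<bar>B\<bar>))" by simp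
  ultimately show False using assms(2) by blast
qed

text \<open>These pairs index cuts in two ways: as (length, offset) for a straight cut, and as
  (length, residue modulo the length) for an arbitrary separating set.\<close>

lemma card_length_residue: "card (SIGMA d:{1..l}. {0..<d}) = l * (l + 1) div 2"
proof -
  have "card (SIGMA d:{1..l}. {0..<d}) = (\<Sum>d=1..l. d)" by simp
  also have "\<dots> = l * (l + 1) div 2"
    using gauss_sum_from_Suc_0[of l, where 'a=nat] by simp
  finally show ?thesis .
qed

lemma card_cut: "card (cut_edges l k) = l * (l + 1) div 2"
proof -
  let ?f = "\<lambda>(d, i). (k - int i, k - int i + int d)"
  have "?f ` (SIGMA d:{1..l}. {0..<d}) = cut_edges l k"
  proof (intro set_eqI iffI)
    fix e assume "e \<in> cut_edges l k"
    then obtain x y where e: "e = (x, y)" "1 \<le> y - x" "y - x \<le> int l" "x \<le> k" "k < y"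
      by (auto simp: cut_edges_def edges_def)
    then have "e = ?f (nat (y - x), nat (k - x))" by auto
    then show "e \<in> ?f ` (SIGMA d:{1..l}. {0..<d})"
      by (rule image_eqI) (use e in auto)
  qed (auto simp: cut_edges_def edges_def)
  moreover have "inj_on ?f (SIGMA d:{1..l}. {0..<d})" by (auto simp: inj_on_def)
  ultimately show ?thesis
    using card_image[of ?f "SIGMA d:{1..l}. {0..<d}"] card_length_residue[of l] by simp
qed

text \<open>An edge determines its index: its length is \<open>d\<close> and its left end is
  \<open>r\<close> modulo \<open>d\<close>. Only edges with the left end in \<open>R\<close> are
  collected; this direction is what later excludes a ragged \<open>R\<close>.\<close>

lemma crossing_edges:
  fixes R :: "int set"
  assumes "\<forall>z\<le>A. z \<in> R" and "\<forall>z\<ge>B. z \<notin> R"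
  shows "\<exists>E \<subseteq> edges l. finite E \<and> card E = l * (l + 1) div 2 \<and>
    (\<forall>x y. (x, y) \<in> E \<longrightarrow> x \<in> R \<and> y \<notin> R)"
proof -
  have "\<forall>d r. \<exists>x. 1 \<le> d \<and> r < d \<longrightarrow> x mod int d = int r \<and> x \<in> R \<and> x + int d \<notin> R"
  proof (intro allI)
    fix d r :: nat
    show "\<exists>x. 1 \<le> d \<and> r < d \<longrightarrow> x mod int d = int r \<and> x \<in> R \<and> x + int d \<notin> R"
      using exists_crossing_step[OF assms, of "int d" "int r"] by auto
  qed
  then obtain X where X: "\<And>d r. 1 \<le> d \<Longrightarrow> r < d \<Longrightarrow> X d r mod int d = int r \<and> X d r \<in> R \<and> X d r + int d \<notin> R"
    by metis
  let ?f = "\<lambda>(d, r). (X d r, X d r + int d)"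
  have "inj_on ?f (SIGMA d:{1..l}. {0..<d})"
  proof (intro inj_onI)
    fix p q assume p: "p \<in> (SIGMA d:{1..l}. {0..<d})" "q \<in> (SIGMA d:{1..l}. {0..<d})" "?f p = ?f q"
    obtain d r d' r' where [simp]: "p = (d, r)" "q = (d', r')" by (metis surj_pair)
    have "d = d'" using p by auto
    moreover from this have "int r = int r'" using p X[of d r] X[of d r'] by auto
    ultimately show "p = q" by simp
  qed
  then have "card (?f ` (SIGMA d:{1..l}. {0..<d})) = l * (l + 1) div 2"
    using card_image[of ?f "SIGMA d:{1..l}. {0..<d}"] card_length_residue[of l] by simp
  then show ?thesis
    by (intro exI[of _ "?f ` (SIGMA d:{1..l}. {0..<d})"]) (use X in \<open>auto simp: edges_def\<close>)
qed

text \<open>In the case of equality every boundary edge leads from \<open>R\<close> on its left to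
  the complement on its right. In particular no unit edge re-enters \<open>R\<close>, so the
  complement is closed under moving right.\<close>

lemma half_line_if_few_crossings:
  fixes R :: "int set"
  assumes "l \<ge> 1" and R: "\<forall>z\<le>A. z \<in> R" "\<forall>z\<ge>B. z \<notin> R"
    and C: "C = {(x, y) \<in> edges l. (x \<in> R) \<noteq> (y \<in> R)}" "finite C" "card C \<le> l * (l + 1) div 2"
  obtains k where "R = {..k}"
proof -
  obtain E where E: "E \<subseteq> edges l" "finite E" "card E = l * (l + 1) div 2"
    "\<And>x y. (x, y) \<in> E \<Longrightarrow> x \<in> R \<and> y \<notin> R"
    using crossing_edges[OF R, of l] by blast
  have "E \<subseteq> C" using E(1,4) by (auto simp: C(1))
  then have "E = C" using C E by (metis card_seteq)
  have step: "z + 1 \<notin> R" if "z \<notin> R" for z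
  proof
    assume "z + 1 \<in> R"
    then have "(z, z + 1) \<in> C" using that \<open>l \<ge> 1\<close> by (auto simp: C(1) edges_def)
    then show False using E(4) that unfolding \<open>E = C\<close> by blast
  qed
  have up: "z' \<notin> R" if "z \<le> z'" "z \<notin> R" for z z'
    using that by (induction rule: int_ge_induct) (auto dest: step)
  obtain k where "k \<in> R" "k + 1 \<notin> R"
    using exists_crossing_step[OF R, of 1 0] by auto
  have "R = {..k}"
  proof (intro set_eqI iffI)
    fix z assume "z \<in> R"
    then show "z \<in> {..k}" using up[of "k + 1" z] \<open>k + 1 \<notin> R\<close> by (cases "z \<le> k") auto
  next
    fix z assume "z \<in> {..k}"
    then show "z \<in> R" using up[of z k] \<open>k \<in> R\<close> by auto
  qed
  then show thesis by (rule that)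
qed

section \<open>Pivots and the separating set of a large passage time\<close>

lemma pivot_jump:
  assumes "pivot l a w v" "x < v" "v < y" "y - x \<le> int l"
  shows "2 * a < w (x, y)"
  using assms unfolding pivot_def by force

text \<open>The definition constrains \<open>(v, y)\<close> only through jumps \<open>(x, y)\<close>
  over \<open>v\<close>. The shortest one starts at v - 1, whence the range l - 1 instead of
  l.\<close>

lemma pivot_right:
  assumes "pivot l a w v" "v < y" "y - v \<le> int l - 1"
  shows "w (v, y) < a"
  using assms unfolding pivot_def by (elim allE[of _ "v - 1"] allE[of _ y]) auto

lemma pivot_left:
  assumes "pivot l a w v" "x < v" "v - x \<le> int l - 1"
  shows "w (x, v) < a"
  using assms unfolding pivot_def by (elim allE[of _ x] allE[of _ "v + 1"]) auto

text \<open>Were the pivots closer, the edge \<open>(u - 1, v)\<close> would be heavy as a jump over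
  \<open>u\<close> and light as an edge into \<open>v\<close>.\<close>

lemma pivot_gap:
  assumes "pivot l a w u" "pivot l a w v" "u < v" "a > 0"
  shows "int l - 1 \<le> v - u"
proof (rule ccontr)
  assume "\<not> ?thesis"
  then have "2 * a < w (u - 1, v)" "w (u - 1, v) < a"
    using assms by (auto intro!: pivot_jump[of l a w u] pivot_left[of l a w v])
  with \<open>a > 0\<close> show False by simp
qed

text \<open>\<open>R\<close> consists of everything left of \<open>u\<close> and of what
  \<open>u\<close> reaches by edges of weight at most \<open>y\<close> inside \<open>{u..v}\<close>.
  Reaching \<open>v\<close> would give a path of cost at most (v - u) y. As
  \<open>a \<le> y\<close>, the light edges at the pivots put a block of l vertices on the correct
  side at either end, so no boundary edge sticks out of \<open>{u..v}\<close>.\<close>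

lemma separating_set:
  assumes "l \<ge> 2" "a > 0" and pivots: "pivot l a w u" "pivot l a w v" and "u < v" "a \<le> y"
    and T: "ereal (real_of_int (v - u) * y) < passage_time l w u v"
  shows "\<exists>R. (\<forall>z\<le>u + int l - 1. z \<in> R) \<and> (\<forall>z\<ge>v - int l + 1. z \<notin> R) \<and>
    (\<forall>s t. (s, t) \<in> edges l \<longrightarrow> (s \<in> R) \<noteq> (t \<in> R) \<longrightarrow> u \<le> s \<and> t \<le> v \<and> y < w (s, t))"
proof -
  define A where "A = {e \<in> edges l \<union> (edges l)\<inverse>. e \<in> {u..v} \<times> {u..v} \<and> arc_weight w e \<le> y}"
  define R where "R = {..<u} \<union> {z. (u, z) \<in> A\<^sup>*}"
  have gap: "int l - 1 \<le> v - u" using pivot_gap pivots \<open>u < v\<close> \<open>a > 0\<close> by blast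
  have reach: "z \<in> {u..v}" if "(u, z) \<in> A\<^sup>*" for z
    using that by (cases rule: rtranclE) (use \<open>u < v\<close> in \<open>auto simp: A_def\<close>)
  have v: "(u, v) \<notin> A\<^sup>*"
  proof
    assume "(u, v) \<in> A\<^sup>*"
    then have "passage_time l w u v \<le> ereal (0 + real_of_int (v - u) * y)"
      \<comment> \<open>A loop is never an arc of the line, so no arc is exceptional and
        \<open>z\<close> is 0.\<close>
      by (rule passage_time_le[where f = "(u, u)"])
        (use assms in \<open>auto simp: A_def edges_def\<close>)
    with T show False by simp
  qed
  have left: "\<forall>z\<le>u + int l - 1. z \<in> R"
  proof (intro allI impI)
    fix z assume z: "z \<le> u + int l - 1"
    have "(u, z) \<in> A" if "u < z"
      using pivot_right[OF pivots(1), of z] that z gap \<open>a \<le> y\<close> \<open>l \<ge> 2\<close> \<open>u < v\<close>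
      by (auto simp: A_def edges_def arc_weight_def)
    then show "z \<in> R" unfolding R_def by (cases z u rule: linorder_cases) auto
  qed
  have right: "\<forall>z\<ge>v - int l + 1. z \<notin> R"
  proof (intro allI impI notI)
    fix z assume z: "v - int l + 1 \<le> z" and "z \<in> R"
    then have uz: "(u, z) \<in> A\<^sup>*" using gap by (auto simp: R_def)
    then have zr: "z \<in> {u..v}" and "z \<noteq> v" using reach v by auto
    then have "(z, v) \<in> A"
      using pivot_left[OF pivots(2), of z] z gap \<open>a \<le> y\<close> \<open>l \<ge> 2\<close> \<open>u < v\<close>
      by (auto simp: A_def edges_def arc_weight_def)
    with uz v show False by (meson rtrancl.rtrancl_into_rtrancl)
  qed
  show ?thesis
  proof (intro exI[of _ R] conjI allI impI)
    fix s t assume st: "(s, t) \<in> edges l" "(s \<in> R) \<noteq> (t \<in> R)"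
    then have "s < t" "t \<le> s + int l" by (auto simp: edges_def)
    have "u \<le> s"
    proof (rule ccontr)
      assume "\<not> u \<le> s"
      then have "s \<in> R" "t \<in> R" using left \<open>t \<le> s + int l\<close> by (auto simp: R_def)
      with st show False by simp
    qed
    have "t \<le> v"
    proof (rule ccontr)
      assume "\<not> t \<le> v"
      then have "s \<notin> R" "t \<notin> R" using right \<open>t \<le> s + int l\<close> by auto
      with st show False by simp
    qed
    have "y < w (s, t)"
    proof (rule ccontr)
      assume "\<not> y < w (s, t)"
      then have "(s, t) \<in> A" "(t, s) \<in> A"
        using st(1) \<open>s < t\<close> \<open>u \<le> s\<close> \<open>t \<le> v\<close> by (auto simp: A_def arc_weight_def)
      then have "(u, s) \<in> A\<^sup>* \<longleftrightarrow> (u, t) \<in> A\<^sup>*" by (meson rtrancl.rtrancl_into_rtrancl)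
      with st(2) \<open>u \<le> s\<close> \<open>s < t\<close> show False by (auto simp: R_def)
    qed
    show "u \<le> s" "t \<le> v" by fact+
    show "y < w (s, t)" by fact
  qed (use left right in auto)
qed

text \<open>The crude form for distant pivots: only the number of heavy edges is recorded, not their
  shape, and \<open>y\<close> may be as small as the total cost divided by the distance.\<close>

lemma many_heavy_edges:
  assumes "l \<ge> 2" "a > 0" and pivots: "pivot l a w u" "pivot l a w v" and "u < v" "a \<le> y"
    and T: "ereal (real_of_int (v - u) * y) < passage_time l w u v"
  shows "\<exists>E \<subseteq> edges l \<inter> {u..v} \<times> {u..v}. card E = l * (l + 1) div 2 \<and> (\<forall>e\<in>E. y < w e)"
proof -
  obtain R where R: "\<forall>z\<le>u + int l - 1. z \<in> R" "\<forall>z\<ge>v - int l + 1. z \<notin> R"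
    "\<And>s t. (s, t) \<in> edges l \<Longrightarrow> (s \<in> R) \<noteq> (t \<in> R) \<Longrightarrow> u \<le> s \<and> t \<le> v \<and> y < w (s, t)"
    using separating_set[OF assms] by blast
  obtain E where E: "E \<subseteq> edges l" "card E = l * (l + 1) div 2"
    "\<And>x y. (x, y) \<in> E \<Longrightarrow> x \<in> R \<and> y \<notin> R"
    using crossing_edges[OF R(1,2), of l] by blast
  have *: "u \<le> s \<and> s < t \<and> t \<le> v \<and> y < w (s, t)" if "(s, t) \<in> E" for s t
    using R(3)[of s t] E(1) E(3)[OF that] that by (auto simp: edges_def)
  show ?thesis
    by (intro exI[of _ E] conjI E(2)) (use * E(1) in \<open>force+\<close>)
qed

text \<open>Without a surplus of edges above \<open>y\<close>, the separating set is a half-line,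
  and the edges above \<open>y\<close> between the pivots form exactly one straight cut. If one of
  them cost at most \<open>z\<close>, a path using it and otherwise only unit steps off the cut
  would cost at most z + (v - u) y.\<close>

lemma heavy_cut:
  assumes "l \<ge> 2" "a > 0" and pivots: "pivot l a w u" "pivot l a w v" and "u < v" "a \<le> y" "0 \<le> z"
    and T: "ereal (z + real_of_int (v - u) * y) < passage_time l w u v"
    and few: "card {e \<in> edges l \<inter> {u..v} \<times> {u..v}. y < w e} \<le> l * (l + 1) div 2"
  shows "\<exists>k. u \<le> k \<and> k < v \<and> (\<forall>e\<in>cut_edges l k. z < w e)"
proof -
  let ?H = "{e \<in> edges l \<inter> {u..v} \<times> {u..v}. y < w e}"
  have fin: "finite ?H" using finite_edges_between by (rule finite_subset[rotated]) auto
  have "ereal (real_of_int (v - u) * y) < passage_time l w u v"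
    using T \<open>0 \<le> z\<close> by (meson ereal_less_eq(3) le_add_same_cancel2 order_le_less_trans)
  then obtain R where R: "\<forall>z\<le>u + int l - 1. z \<in> R" "\<forall>z\<ge>v - int l + 1. z \<notin> R"
    "\<And>s t. (s, t) \<in> edges l \<Longrightarrow> (s \<in> R) \<noteq> (t \<in> R) \<Longrightarrow> u \<le> s \<and> t \<le> v \<and> y < w (s, t)"
    using separating_set[OF assms(1-6)] by blast
  define C where "C = {(x, y) \<in> edges l. (x \<in> R) \<noteq> (y \<in> R)}"
  have "C \<subseteq> ?H"
  proof (rule subrelI)
    fix s t assume "(s, t) \<in> C"
    then show "(s, t) \<in> ?H" using R(3)[of s t] by (auto simp: C_def edges_def)
  qed
  then have "finite C" "card C \<le> l * (l + 1) div 2"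
    using fin few card_mono[OF fin, of C] finite_subset[OF _ fin, of C] by auto
  then obtain k where k: "R = {..k}"
    using half_line_if_few_crossings[OF _ R(1,2) C_def] \<open>l \<ge> 2\<close> by fastforce
  have "C = cut_edges l k" by (auto simp: C_def k cut_edges_def edges_def)
  then have H: "?H = cut_edges l k" using \<open>C \<subseteq> ?H\<close> fin few card_cut[of l k] by (metis card_seteq)
  have "u \<in> R" using R(1) \<open>l \<ge> 2\<close> by auto
  moreover have "v \<notin> R" using R(2) \<open>l \<ge> 2\<close> by auto
  ultimately have "u \<le> k" "k < v" by (auto simp: k)
  have "z < w e" if e: "e \<in> cut_edges l k" for e
  proof (rule ccontr)
    assume "\<not> z < w e"
    obtain s t where [simp]: "e = (s, t)" by (cases e)
    \<comment> \<open>Unit steps from \<open>u\<close> to \<open>s\<close>, the edge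
      \<open>(s, t)\<close>, unit steps from \<open>t\<close> to \<open>v\<close>; the unit step
      across the cut is left out unless it is \<open>(s, t)\<close> itself.\<close>
    define A where "A = insert (s, t) {(i, i + 1) |i. u \<le> i \<and> i < v \<and> i \<noteq> k}"
    have "(s, t) \<in> ?H" using e H by simp
    then have st: "u \<le> s" "t \<le> v" "(s, t) \<in> edges l" "s \<le> k" "k < t"
      using e by (simp_all add: cut_edges_def)
    have "(u, i) \<in> A\<^sup>*" if "u \<le> i" "i \<le> k" for i
      using that
    proof (induction rule: int_ge_induct)
      case (step i)
      then have "(i, i + 1) \<in> A" using \<open>k < v\<close> by (auto simp: A_def)
      with step show ?case by (simp add: rtrancl.rtrancl_into_rtrancl)
    qed simp
    then have "(u, s) \<in> A\<^sup>*" using st by simp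
    also have "(s, t) \<in> A" by (simp add: A_def)
    also have "(t, i) \<in> A\<^sup>*" if "t \<le> i" "i \<le> v" for i
      using that
    proof (induction rule: int_ge_induct)
      case (step i)
      then have "(i, i + 1) \<in> A" using st \<open>u \<le> k\<close> by (auto simp: A_def)
      with step show ?case by (simp add: rtrancl.rtrancl_into_rtrancl)
    qed simp
    then have "(t, v) \<in> A\<^sup>*" using st by simp
    finally have uv: "(u, v) \<in> A\<^sup>*" .
    have "passage_time l w u v \<le> ereal (z + real_of_int (v - u) * y)"
    proof (rule passage_time_le[OF uv, where f = "(s, t)"])
      show "A \<subseteq> {u..v} \<times> {u..v}" using st \<open>u \<le> k\<close> by (auto simp: A_def)
      show "A \<subseteq> edges l \<union> (edges l)\<inverse>" using st \<open>l \<ge> 2\<close> by (auto simp: A_def edges_def)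
      show "arc_weight w (s, t) \<le> z" using \<open>\<not> z < w e\<close> st by (simp add: arc_weight_def)
      fix f assume "f \<in> A" "f \<noteq> (s, t)"
      then obtain i where i: "f = (i, i + 1)" "u \<le> i" "i < v" "i \<noteq> k" by (auto simp: A_def)
      then have "f \<notin> cut_edges l k" by (auto simp: cut_edges_def)
      then have "\<not> y < w f" unfolding H[symmetric] using i \<open>l \<ge> 2\<close> by (auto simp: edges_def)
      then show "arc_weight w f \<le> y" using i by (simp add: arc_weight_def)
    qed (use assms in auto)
    with T show False by simp
  qed
  with \<open>u \<le> k\<close> \<open>k < v\<close> show ?thesis by blast
qed

section \<open>Regularly varying tails\<close>

lemma survival_antimono:
  assumes "real_distribution D" "x \<le> y"
  shows "survival D y \<le> survival D x"
proof -
  interpret real_distribution D by fact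
  show ?thesis unfolding survival_def using assms(2) by (intro finite_measure_mono) auto
qed

lemma survival_bounds:
  assumes "real_distribution D"
  shows "0 \<le> survival D x" "survival D x \<le> 1"
proof -
  interpret real_distribution D by fact
  show "0 \<le> survival D x" "survival D x \<le> 1" unfolding survival_def by auto
qed

lemma survival_tendsto_0:
  assumes "real_distribution D"
  shows "(survival D \<longlongrightarrow> 0) at_top"
proof -
  interpret real_distribution D by fact
  have "survival D = (\<lambda>x. 1 - cdf D x)"
  proof
    fix x
    have "{x<..} = space D - {..x}" by auto
    then show "survival D x = 1 - cdf D x" unfolding survival_def cdf_def using prob_compl[of "{..x}"] by simp
  qed
  moreover have "((\<lambda>x. 1 - cdf D x) \<longlongrightarrow> 1 - 1) at_top"
    by (intro tendsto_intros cdf_lim_at_top_prob)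
  ultimately show ?thesis by simp
qed

locale regular_tail =
  fixes D :: "real measure" and \<gamma> :: real and L :: "real \<Rightarrow> real"
  assumes distribution: "real_distribution D"
    and slowly_varying: "slowly_varying L"
    and tail: "\<forall>\<^sub>F x in at_top. survival D x = x powr (- \<gamma>) * L x"
begin

lemma survival_pos: "0 < survival D x"
proof -
  obtain X where "\<forall>x\<ge>X. 0 < L x" using slowly_varying by (auto simp: slowly_varying_def)
  then have "\<forall>\<^sub>F y in at_top. 0 < L y" by (auto simp: eventually_at_top_linorder)
  with tail have "\<forall>\<^sub>F y in at_top. 0 < survival D y \<and> x \<le> y"
    using eventually_gt_at_top[of 0] eventually_ge_at_top[of x]
    by eventually_elim auto
  then obtain y where "0 < survival D y" "x \<le> y"
    using eventually_happens by (fastforce simp: trivial_limit_at_top_linorder)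
  then show ?thesis using survival_antimono[OF distribution, of x y] by simp
qed

lemma survival_scale:
  assumes "0 < t"
  shows "((\<lambda>x. survival D (t * x) / survival D x) \<longlongrightarrow> t powr (- \<gamma>)) at_top"
proof -
  have "filterlim (\<lambda>x. t * x) at_top at_top"
    using assms by (intro filterlim_tendsto_pos_mult_at_top[OF tendsto_const _ filterlim_ident]) auto
  with tail have tail': "\<forall>\<^sub>F x in at_top. survival D (t * x) = (t * x) powr (- \<gamma>) * L (t * x)"
    by (auto simp: filterlim_iff)
  have "((\<lambda>x. L (t * x) / L x) \<longlongrightarrow> 1) at_top"
    using slowly_varying assms by (auto simp: slowly_varying_def)
  then have "((\<lambda>x. t powr (- \<gamma>) * (L (t * x) / L x)) \<longlongrightarrow> t powr (- \<gamma>) * 1) at_top"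
    by (intro tendsto_intros)
  moreover have "\<forall>\<^sub>F x in at_top. t powr (- \<gamma>) * (L (t * x) / L x) = survival D (t * x) / survival D x"
    using tail tail' eventually_gt_at_top[of 0]
    by eventually_elim (use assms in \<open>auto simp: powr_mult\<close>)
  ultimately have "((\<lambda>x. survival D (t * x) / survival D x) \<longlongrightarrow> t powr (- \<gamma>) * 1) at_top"
    by (rule Lim_transform_eventually)
  then show ?thesis by simp
qed

text \<open>Large arguments are governed by the limit of the ratio; below \<open>X\<close> the tail
  is at least its positive value at \<open>X\<close>. So one constant serves every real
  \<open>x\<close>.\<close>

lemma survival_doubling: "\<exists>A::nat. \<forall>x. survival D (x / 2) \<le> 2 ^ A * survival D x"
proof -
  have "\<forall>\<^sub>F x in at_top. survival D (1/2 * x) / survival D x < (1/2) powr (- \<gamma>) + 1"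
    using survival_scale[of "1/2"] by (intro order_tendstoD) auto
  then obtain X where X: "\<And>x. X \<le> x \<Longrightarrow> survival D (1/2 * x) / survival D x < (1/2) powr (- \<gamma>) + 1"
    by (auto simp: eventually_at_top_linorder)
  obtain A :: nat where A: "max ((1/2) powr (- \<gamma>) + 1) (1 / survival D X) < 2 ^ A"
    using real_arch_pow[of 2 "max ((1/2) powr (- \<gamma>) + 1) (1 / survival D X)"]
    by (auto simp del: max_less_iff_conj)
  have "survival D (x / 2) \<le> 2 ^ A * survival D x" for x
  proof (cases "X \<le> x")
    case True
    then have "survival D (x / 2) \<le> ((1/2) powr (- \<gamma>) + 1) * survival D x"
      using X[OF True] survival_pos[of x] by (simp add: field_simps)
    also have "\<dots> \<le> 2 ^ A * survival D x"
      using A survival_pos[of x] by (intro mult_right_mono) auto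
    finally show ?thesis .
  next
    case False
    have "survival D (x / 2) \<le> 1" by (rule survival_bounds[OF distribution])
    also have "1 \<le> 2 ^ A * survival D X" using A survival_pos[of X] by (simp add: field_simps)
    also have "\<dots> \<le> 2 ^ A * survival D x"
      using False survival_antimono[OF distribution, of x X] by (intro mult_left_mono) auto
    finally show ?thesis .
  qed
  then show ?thesis by blast
qed

text \<open>A Potter-type bound obtained by repeated halving. Its exponent is not sharp, but any
  polynomial in \<open>m\<close> is good enough against exponential decay.\<close>

lemma survival_divide:
  "\<exists>A::nat. \<forall>x\<ge>0. \<forall>m::real. 1 \<le> m \<longrightarrow> survival D (x / m) \<le> (2 * m) ^ A * survival D x"
proof -
  obtain A :: nat where A: "\<And>x. survival D (x / 2) \<le> 2 ^ A * survival D x"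
    using survival_doubling by blast
  have pow: "survival D (x / 2 ^ j) \<le> (2 ^ A) ^ j * survival D x" for x j
  proof (induction j)
    case (Suc j)
    have "survival D (x / 2 ^ Suc j) \<le> 2 ^ A * survival D (x / 2 ^ j)"
      using A[of "x / 2 ^ j"] by (simp add: field_simps)
    also have "\<dots> \<le> 2 ^ A * ((2 ^ A) ^ j * survival D x)" using Suc by (intro mult_left_mono) auto
    finally show ?case by (simp add: mult_ac)
  qed simp
  have "survival D (x / m) \<le> (2 * m) ^ A * survival D x" if "0 \<le> x" "1 \<le> m" for x m :: real
  proof -
    \<comment> \<open>Rounds \<open>m\<close> up to a power of two; by minimality this loses at most
      the factor 2 seen in the bound.\<close>
    define j where "j = (LEAST j. m \<le> 2 ^ j)"
    have ex: "\<exists>j. m \<le> 2 ^ j" using real_arch_pow[of 2 m] by (auto intro: less_imp_le)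
    have j: "m \<le> 2 ^ j" unfolding j_def using ex by (rule LeastI_ex)
    have "2 ^ j \<le> 2 * m"
    proof (cases j)
      case (Suc i)
      then have "\<not> m \<le> 2 ^ i" using not_less_Least[of i "\<lambda>j. m \<le> 2 ^ j"] by (simp add: j_def)
      then show ?thesis using Suc by simp
    qed (use that in auto)
    have "survival D (x / m) \<le> survival D (x / 2 ^ j)"
      using that j by (intro survival_antimono[OF distribution] divide_left_mono) auto
    also have "\<dots> \<le> (2 ^ j) ^ A * survival D x" using pow[of x j] by (simp add: power_mult[symmetric] mult.commute)
    also have "\<dots> \<le> (2 * m) ^ A * survival D x"
      using \<open>2 ^ j \<le> 2 * m\<close> survival_pos[of x] by (intro mult_right_mono power_mono) auto
    finally show ?thesis .
  qed
  then show ?thesis by blast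
qed

end

text \<open>The shape of the estimates to come: a grid of mesh \<open>k\<close> below
  \<open>m\<close> supplies about m / k independent trials, a bounded number \<open>c\<close> of
  which is discarded.\<close>

lemma summable_poly_geometric:
  fixes q :: real
  assumes "0 < q" "q < 1" "1 \<le> k"
  shows "summable (\<lambda>m. (real m + 2) ^ B * q ^ (m div k - c))"
proof -
  \<comment> \<open>The geometric rate per unit of \<open>m\<close> rather than per block of length
    \<open>k\<close>.\<close>
  define r where "r = q powr (1 / real k)"
  have "r < q powr 0" unfolding r_def using assms by (intro powr_less_mono') auto
  then have r: "0 < r" "r < 1" using assms by (auto simp: r_def)
  have "(\<lambda>m. ((real m + 3) / (real m + 2)) ^ B * r) \<longlonglongrightarrow> 1 ^ B * r"
    by (intro tendsto_intros) real_asymp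
  then have "\<forall>\<^sub>F m in sequentially. ((real m + 3) / (real m + 2)) ^ B * r < (1 + r) / 2"
    using r by (intro order_tendstoD(2)) auto
  then obtain N where N: "\<And>m. N \<le> m \<Longrightarrow> ((real m + 3) / (real m + 2)) ^ B * r < (1 + r) / 2"
    by (auto simp: eventually_sequentially)
  have "summable (\<lambda>m. (real m + 2) ^ B * r ^ m)"
  proof (rule summable_ratio_test)
    show "(1 + r) / 2 < 1" using r by simp
    fix m assume "N \<le> m"
    have "norm ((real (Suc m) + 2) ^ B * r ^ Suc m) =
        (((real m + 3) / (real m + 2)) ^ B * r) * ((real m + 2) ^ B * r ^ m)"
      using r by (simp add: power_divide abs_mult add_ac)
    also have "\<dots> \<le> (1 + r) / 2 * ((real m + 2) ^ B * r ^ m)"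
      using N[OF \<open>N \<le> m\<close>] r by (intro mult_right_mono) auto
    finally show "norm ((real (Suc m) + 2) ^ B * r ^ Suc m) \<le> (1 + r) / 2 * norm ((real m + 2) ^ B * r ^ m)"
      using r by (simp add: abs_mult)
  qed
  \<comment> \<open>One factor 1 / q pays for rounding m / k down, the other \<open>c\<close> for
    the discarded trials.\<close>
  then have "summable (\<lambda>m. q powr (- (real c + 1)) * ((real m + 2) ^ B * r ^ m))"
    by (rule summable_mult)
  then show ?thesis
  proof (rule summable_comparison_test', unfold real_norm_def)
    fix m :: nat
    have "real m = real (m div k) * real k + real (m mod k)"
      by (metis of_nat_add of_nat_mult div_mult_mod_eq)
    moreover have "real (m mod k) \<le> real k" using assms(3) by (simp add: less_imp_le)
    ultimately have "real m / real k \<le> real (m div k) + 1"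
      using assms(3) by (simp add: field_simps)
    then have "real m / real k - (real c + 1) \<le> real (m div k - c)" by linarith
    then have "q ^ (m div k - c) \<le> q powr (real m / real k - (real c + 1))"
      using assms by (subst powr_realpow[symmetric]) (auto intro!: powr_mono')
    also have "\<dots> = q powr (- (real c + 1)) * r powr real m"
      by (simp add: r_def powr_powr powr_add[symmetric] algebra_simps)
    also have "r powr real m = r ^ m" using r by (simp add: powr_realpow)
    finally have "(real m + 2) ^ B * q ^ (m div k - c)
        \<le> (real m + 2) ^ B * (q powr (- (real c + 1)) * r ^ m)"
      by (intro mult_left_mono) auto
    then show "\<bar>(real m + 2) ^ B * q ^ (m div k - c)\<bar>
        \<le> q powr (- (real c + 1)) * ((real m + 2) ^ B * r ^ m)"
      using assms by (simp add: mult_ac abs_mult)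
  qed
qed

section \<open>Independence and the density of pivots\<close>

locale spread_out_fpp = prob_space M for M :: "'a measure" +
  fixes W :: "int \<times> int \<Rightarrow> 'a \<Rightarrow> real" and D :: "real measure" and l :: nat and a :: real
  assumes range: "l \<ge> 2"
    and law: "real_distribution D"
    and law_nonneg: "AE t in D. 0 \<le> t"
    and a_pos: "0 < a"
    and law_heavy: "0 < measure D {2 * a<..}"
    and law_light: "0 < measure D {..<a}"
    and indep: "indep_vars (\<lambda>_. borel) W (edges l)"
    and distr_weight: "\<And>e. e \<in> edges l \<Longrightarrow> distr M borel (W e) = D"
begin

abbreviation weights :: "'a \<Rightarrow> int \<times> int \<Rightarrow> real" where
  "weights \<omega> \<equiv> \<lambda>e. W e \<omega>"

text \<open>Records which edges an event depends on, so that independence reduces to disjointness of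
  edge sets.\<close>

definition weight_algebra :: "(int \<times> int) set \<Rightarrow> 'a measure" where
  "weight_algebra K = sigma (space M) (\<Union>e\<in>K. {W e -` B \<inter> space M |B. B \<in> sets borel})"

lemma space_weight_algebra [simp]: "space (weight_algebra K) = space M"
  by (simp add: weight_algebra_def space_measure_of_conv)

lemma sets_weight_algebra:
  "sets (weight_algebra K) = sigma_sets (space M) (\<Union>e\<in>K. {W e -` B \<inter> space M |B. B \<in> sets borel})"
  unfolding weight_algebra_def by (intro sets_measure_of) auto

lemma weight_measurable: "e \<in> K \<Longrightarrow> W e \<in> borel_measurable (weight_algebra K)"
  by (intro measurableI) (auto simp: sets_weight_algebra)

lemma indep_weight_algebras:
  assumes "K1 \<subseteq> edges l" "K2 \<subseteq> edges l" "K1 \<inter> K2 = {}"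
    and "A \<in> sets (weight_algebra K1)" "B \<in> sets (weight_algebra K2)"
  shows "prob (A \<inter> B) = prob A * prob B"
proof -
  let ?K = "\<lambda>b. if b then K1 else K2"
  have "indep_sets (\<lambda>e. {W e -` B \<inter> space M |B. B \<in> sets borel}) (edges l)"
    using indep unfolding indep_vars_def2 by blast
  then have "indep_sets (\<lambda>e. {W e -` B \<inter> space M |B. B \<in> sets borel}) (\<Union>b\<in>UNIV. ?K b)"
    by (rule indep_sets_mono_index[rotated]) (use assms(1,2) in \<open>auto split: if_splits\<close>)
  then have "indep_sets (\<lambda>b. sigma_sets (space M) (\<Union>e\<in>?K b. {W e -` B \<inter> space M |B. B \<in> sets borel})) UNIV"
  proof (rule indep_sets_collect_sigma)
    fix e
    show "Int_stable {W e -` B \<inter> space M |B. B \<in> sets borel}"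
    proof (rule Int_stableI)
      fix X Y assume "X \<in> {W e -` B \<inter> space M |B. B \<in> sets borel}" "Y \<in> {W e -` B \<inter> space M |B. B \<in> sets borel}"
      then obtain B C where "X = W e -` B \<inter> space M" "Y = W e -` C \<inter> space M" "B \<in> sets borel" "C \<in> sets borel"
        by auto
      then show "X \<inter> Y \<in> {W e -` B \<inter> space M |B. B \<in> sets borel}"
        by (intro CollectI exI[of _ "B \<inter> C"]) auto
    qed
    show "disjoint_family_on ?K UNIV" using assms(3) by (auto simp: disjoint_family_on_def)
  qed
  then have "prob (\<Inter>b\<in>UNIV. (if b then A else B)) = (\<Prod>b\<in>UNIV. prob (if b then A else B))"
    by (rule indep_setsD) (use assms in \<open>auto simp: sets_weight_algebra\<close>)
  then show ?thesis by (simp add: UNIV_bool Int_commute mult.commute)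
qed

lemma random_weight: "e \<in> edges l \<Longrightarrow> random_variable borel (W e)"
  using indep unfolding indep_vars_def2 by blast

lemma weight_algebra_events:
  assumes "K \<subseteq> edges l"
  shows "sets (weight_algebra K) \<subseteq> events"
  unfolding sets_weight_algebra
  by (rule sets.sigma_sets_subset) (use assms random_weight in \<open>force intro: measurable_sets\<close>)

lemma pred_weight_algebra:
  "Measurable.pred (weight_algebra K) P \<longleftrightarrow> {\<omega> \<in> space M. P \<omega>} \<in> sets (weight_algebra K)"
  by (simp add: pred_def)

lemma heavy_edges_measurable:
  assumes "finite E" "E \<subseteq> K"
  shows "Measurable.pred (weight_algebra K) (\<lambda>\<omega>. \<forall>e\<in>E. y < W e \<omega>)"
proof -
  have [measurable]: "W e \<in> borel_measurable (weight_algebra K)" if "e \<in> E" for e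
    using weight_measurable that assms(2) by blast
  show ?thesis using assms(1) by (intro pred_intros_finite) measurable
qed

lemma prob_rectangle:
  assumes "finite E" "E \<subseteq> edges l" "\<And>e. B e \<in> sets borel"
  shows "prob {\<omega> \<in> space M. \<forall>e\<in>E. W e \<omega> \<in> B e} = (\<Prod>e\<in>E. measure D (B e))"
  using assms(1,2)
proof (induction E)
  case empty
  then show ?case by (simp add: prob_space)
next
  case (insert e E)
  have 1: "{\<omega> \<in> space M. \<forall>e\<in>E. W e \<omega> \<in> B e} \<in> sets (weight_algebra E)"
    unfolding pred_weight_algebra[symmetric] using insert.hyps assms(3)
    by (intro pred_intros_finite pred_sets2[where N = borel] weight_measurable)
  have 2: "W e -` B e \<inter> space M \<in> sets (weight_algebra {e})"
    using assms(3) measurable_sets[OF weight_measurable[of e "{e}"], of "B e"] by simp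
  have "prob (W e -` B e \<inter> space M) = measure D (B e)"
    using distr_weight[of e] random_weight[of e] insert.prems assms(3) measure_distr[of "W e" M borel "B e"]
    by simp
  moreover have "{\<omega> \<in> space M. \<forall>f\<in>insert e E. W f \<omega> \<in> B f} =
      (W e -` B e \<inter> space M) \<inter> {\<omega> \<in> space M. \<forall>e\<in>E. W e \<omega> \<in> B e}" by auto
  ultimately show ?case
    using indep_weight_algebras[OF _ _ _ 2 1] insert by simp
qed

lemma prob_heavy_edges:
  assumes "finite E" "E \<subseteq> edges l"
  shows "prob {\<omega> \<in> space M. \<forall>e\<in>E. y < W e \<omega>} = survival D y ^ card E"
  using prob_rectangle[OF assms, of "\<lambda>_. {y<..}"] by (simp add: survival_def)

text \<open>
  The edges that decide whether \<^term>\<open>v\<close> is a pivot. The edge $(v, v+\ell)$ carries no constraint;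
  leaving it out makes the pivots up to $k-\ell+1$ independent of the cut between $k$ and $k+1$.
\<close>
definition star :: "int \<Rightarrow> (int \<times> int) set" where
  "star v = {(x, y) \<in> edges l. x \<le> v \<and> v \<le> y \<and> y < v + int l}"

lemma star_edges: "star v \<subseteq> edges l"
  by (auto simp: star_def)

lemma star_box: "star v \<subseteq> {v - int l..v + int l} \<times> {v - int l..v + int l}"
  by (auto simp: star_def edges_def)

lemma finite_star: "finite (star v)"
  by (rule finite_subset[OF star_box]) simp

lemma card_star: "card (star v) \<le> (2 * l + 1) ^ 2"
proof -
  have card_box: "card {v - int l..v + int l} = 2 * l + 1" by simp
  have "card (star v) \<le> card ({v - int l..v + int l} \<times> {v - int l..v + int l})"
    by (intro card_mono star_box) simp
  also have "\<dots> = (2 * l + 1) ^ 2"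
    using card_box by (simp add: card_cartesian_product power2_eq_square)
  finally show ?thesis .
qed

text \<open>A common edge would have both \<open>u\<close> and \<open>v\<close> between its ends,
  but its length is at most \<open>l\<close>.\<close>

lemma star_disjoint:
  assumes "int l < \<bar>u - v\<bar>"
  shows "star u \<inter> star v = {}"
  using assms by (auto simp: star_def edges_def)

lemma pivot_measurable:
  assumes "star v \<subseteq> K"
  shows "Measurable.pred (weight_algebra K) (\<lambda>\<omega>. pivot l a (weights \<omega>) v)"
proof -
  have "Measurable.pred (weight_algebra K) (\<lambda>\<omega>. x < v \<and> v < y \<and> 2 \<le> y - x \<and> y - x \<le> int l \<longrightarrow>
        W (x, v) \<omega> < a \<and> W (v, y) \<omega> < a \<and> W (x, y) \<omega> > 2 * a)" for x y
  proof (cases "x < v \<and> v < y \<and> 2 \<le> y - x \<and> y - x \<le> int l")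
    case True
    then have "(x, v) \<in> K" "(v, y) \<in> K" "(x, y) \<in> K"
      using assms by (auto simp: star_def edges_def)
    note [measurable] = this[THEN weight_measurable]
    show ?thesis by measurable
  next
    case False
    then have "(\<lambda>\<omega>. x < v \<and> v < y \<and> 2 \<le> y - x \<and> y - x \<le> int l \<longrightarrow>
        W (x, v) \<omega> < a \<and> W (v, y) \<omega> < a \<and> W (x, y) \<omega> > 2 * a) = (\<lambda>_. True)" by auto
    then show ?thesis by simp
  qed
  then show ?thesis unfolding pivot_def by (intro pred_intros_countable)
qed

lemma pivot_event [measurable]: "Measurable.pred M (\<lambda>\<omega>. pivot l a (weights \<omega>) v)"
  using pivot_measurable[OF order_refl, of v] weight_algebra_events[OF star_edges, of v]
  by (auto simp: pred_def)

text \<open>Each edge of a star meets the demand on it with at least the smaller of the two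
  probabilities, and a star has at most (2 l + 1)^2 edges. The cap 1 / 2 keeps 1 -
  \<open>pivot_bound\<close> positive, as the geometric sums require.\<close>

definition pivot_bound :: real where
  "pivot_bound = min (1 / 2) (min (measure D {..<a}) (measure D {2 * a<..}) ^ (2 * l + 1)\<^sup>2)"

lemma pivot_bound: "0 < pivot_bound" "pivot_bound < 1"
  using law_heavy law_light by (auto simp: pivot_bound_def)

lemma prob_pivot: "pivot_bound \<le> prob {\<omega> \<in> space M. pivot l a (weights \<omega>) v}"
proof -
  interpret D: real_distribution D by (rule law)
  \<comment> \<open>Edges of the star that end at \<open>v\<close> are to be light, those passing
    over \<open>v\<close> heavy: this suffices for a pivot and is a product event.\<close>
  let ?B = "\<lambda>e. if fst e = v \<or> snd e = v then {..<a} else {2 * a<..}"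
  let ?q = "min (measure D {..<a}) (measure D {2 * a<..})"
  have q: "0 \<le> ?q" "?q \<le> 1" using D.prob_le_1 by (auto simp: min.coboundedI1)
  have "pivot_bound \<le> ?q ^ (2 * l + 1)\<^sup>2" by (simp add: pivot_bound_def)
  also have "\<dots> \<le> ?q ^ card (star v)" using card_star q by (intro power_decreasing) auto
  also have "\<dots> = (\<Prod>e\<in>star v. ?q)" by simp
  also have "\<dots> \<le> (\<Prod>e\<in>star v. measure D (?B e))" using q by (intro prod_mono) auto
  also have "\<dots> = prob {\<omega> \<in> space M. \<forall>e\<in>star v. W e \<omega> \<in> ?B e}"
    by (intro prob_rectangle[symmetric] finite_star star_edges) auto
  also have "\<dots> \<le> prob {\<omega> \<in> space M. pivot l a (weights \<omega>) v}"
  proof (intro finite_measure_mono subsetI)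
    fix \<omega> assume "\<omega> \<in> {\<omega> \<in> space M. \<forall>e\<in>star v. W e \<omega> \<in> ?B e}"
    then have \<omega>: "\<omega> \<in> space M" and B: "\<And>e. e \<in> star v \<Longrightarrow> W e \<omega> \<in> ?B e" by auto
    have "W (x, v) \<omega> < a \<and> W (v, y) \<omega> < a \<and> 2 * a < W (x, y) \<omega>"
      if "x < v" "v < y" "2 \<le> y - x" "y - x \<le> int l" for x y
      using B[of "(x, v)"] B[of "(v, y)"] B[of "(x, y)"] that by (auto simp: star_def edges_def)
    with \<omega> show "\<omega> \<in> {\<omega> \<in> space M. pivot l a (weights \<omega>) v}" by (auto simp: pivot_def)
  qed simp
  finally show ?thesis .
qed

text \<open>\<open>E\<close> and the stars of the vertices in \<open>J\<close> are pairwise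
  disjoint, so every vertex contributes an independent factor.\<close>

lemma prob_heavy_no_pivots:
  assumes E: "finite E" "E \<subseteq> edges l" and "finite J"
    and "\<And>v. v \<in> J \<Longrightarrow> star v \<inter> E = {}"
    and "\<And>u v. u \<in> J \<Longrightarrow> v \<in> J \<Longrightarrow> u \<noteq> v \<Longrightarrow> int l < \<bar>u - v\<bar>"
  shows "prob {\<omega> \<in> space M. (\<forall>e\<in>E. y < W e \<omega>) \<and> (\<forall>v\<in>J. \<not> pivot l a (weights \<omega>) v)}
    \<le> survival D y ^ card E * (1 - pivot_bound) ^ card J"
  using assms(3-5)
proof (induction J)
  case empty
  then show ?case using prob_heavy_edges[OF E, of y] by simp
next
  case (insert v J)
  let ?K = "E \<union> (\<Union>u\<in>J. star u)"
  let ?R = "{\<omega> \<in> space M. (\<forall>e\<in>E. y < W e \<omega>) \<and> (\<forall>v\<in>J. \<not> pivot l a (weights \<omega>) v)}"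
  let ?V = "{\<omega> \<in> space M. \<not> pivot l a (weights \<omega>) v}"
  have [measurable]: "Measurable.pred (weight_algebra ?K) (\<lambda>\<omega>. pivot l a (weights \<omega>) u)" if "u \<in> J" for u
    using that by (intro pivot_measurable) auto
  have [measurable]: "Measurable.pred (weight_algebra ?K) (\<lambda>\<omega>. \<forall>v\<in>J. \<not> pivot l a (weights \<omega>) v)"
    using insert.hyps(1) by (intro pred_intros_finite) measurable
  have [measurable]: "Measurable.pred (weight_algebra ?K) (\<lambda>\<omega>. \<forall>e\<in>E. y < W e \<omega>)"
    by (intro heavy_edges_measurable E(1)) auto
  have R: "?R \<in> sets (weight_algebra ?K)"
    unfolding pred_weight_algebra[symmetric] by measurable
  have [measurable]: "Measurable.pred (weight_algebra (star v)) (\<lambda>\<omega>. pivot l a (weights \<omega>) v)"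
    by (intro pivot_measurable) auto
  have V: "?V \<in> sets (weight_algebra (star v))"
    unfolding pred_weight_algebra[symmetric] by measurable
  have disj: "star v \<inter> ?K = {}"
    using insert.prems insert.hyps star_disjoint[of v] by fastforce
  have "?V = space M - {\<omega> \<in> space M. pivot l a (weights \<omega>) v}" by auto
  then have "prob ?V = 1 - prob {\<omega> \<in> space M. pivot l a (weights \<omega>) v}"
    by (simp add: prob_compl)
  then have "prob ?V \<le> 1 - pivot_bound" using prob_pivot[of v] by simp
  moreover have "prob ?R \<le> survival D y ^ card E * (1 - pivot_bound) ^ card J"
    using insert by auto
  ultimately have "prob ?V * prob ?R \<le> (1 - pivot_bound) * (survival D y ^ card E * (1 - pivot_bound) ^ card J)"
    using pivot_bound by (intro mult_mono) auto
  moreover have "{\<omega> \<in> space M. (\<forall>e\<in>E. y < W e \<omega>) \<and> (\<forall>v\<in>insert v J. \<not> pivot l a (weights \<omega>) v)} = ?V \<inter> ?R"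
    by auto
  moreover have "prob (?V \<inter> ?R) = prob ?V * prob ?R"
    by (rule indep_weight_algebras[OF _ _ disj V R]) (use E star_edges in auto)
  ultimately show ?case using insert.hyps by (simp add: mult_ac)
qed

text \<open>
  Vertices at distance more than \<^term>\<open>l\<close> have disjoint stars, so on a grid of mesh \<^term>\<open>l + 1\<close> each
  prescribed heavy edge spoils at most one grid point.
\<close>
lemma prob_heavy_few_pivots:
  assumes E: "finite E" "E \<subseteq> edges l"
  shows "prob {\<omega> \<in> space M. (\<forall>e\<in>E. y < W e \<omega>) \<and>
      (\<forall>u v. 0 \<le> u \<and> u < v \<and> v < int m \<longrightarrow> \<not> (pivot l a (weights \<omega>) u \<and> pivot l a (weights \<omega>) v))}
    \<le> real (m + 1) * survival D y ^ card E * (1 - pivot_bound) ^ (m div (l + 1) - (card E + 1))"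
    (is "prob ?A \<le> _")
proof -
  define n where "n = m div (l + 1)"
  define g where "g = (\<lambda>j::nat. int (j * (l + 1)))"
  define bad where "bad = {j \<in> {..<n}. star (g j) \<inter> E \<noteq> {}}"
  \<comment> \<open>\<open>bad\<close> grid points share an edge with \<open>E\<close>, and
    \<open>i\<close> is the one grid point still allowed to be a pivot. The union over
    \<open>i\<close> costs the factor m + 1.\<close>
  define J where "J i = g ` ({..<n} - bad - {i})" for i
  have g_sep: "int l < \<bar>g i - g j\<bar>" if "i \<noteq> j" for i j
  proof -
    have "1 * (int l + 1) \<le> \<bar>int i - int j\<bar> * (int l + 1)"
      using that by (intro mult_right_mono) auto
    also have "\<dots> = \<bar>(int i - int j) * (int l + 1)\<bar>" by (simp add: abs_mult)
    also have "(int i - int j) * (int l + 1) = g i - g j" by (simp add: g_def algebra_simps)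
    finally show ?thesis by simp
  qed
  have inj_g: "inj g" by (rule injI, rule ccontr) (use g_sep in force)
  have g_less: "g j < int m" if "j < n" for j
  proof -
    have "j * (l + 1) < n * (l + 1)" by (rule mult_strict_right_mono) (use that in auto)
    also have "\<dots> \<le> m" unfolding n_def by (rule div_times_less_eq_dividend)
    finally show ?thesis by (simp add: g_def del: of_nat_mult)
  qed
  have "card bad \<le> card E"
  proof -
    have "\<forall>j\<in>bad. \<exists>e. e \<in> star (g j) \<inter> E" by (auto simp: bad_def)
    then obtain f where f: "\<And>j. j \<in> bad \<Longrightarrow> f j \<in> star (g j) \<inter> E" by metis
    have "inj_on f bad"
    proof (rule inj_onI)
      fix i j assume "i \<in> bad" "j \<in> bad" "f i = f j"
      then have "star (g i) \<inter> star (g j) \<noteq> {}" using f by (metis IntD1 IntI empty_iff)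
      then show "i = j" using star_disjoint g_sep by blast
    qed
    then show ?thesis using f E(1) by (intro card_inj_on_le[of f]) auto
  qed
  then have card_J: "n - (card E + 1) \<le> card (J i)" for i
  proof -
    have "card (J i) = card ({..<n} - bad - {i})"
      unfolding J_def by (intro card_image inj_on_subset[OF inj_g]) auto
    also have "\<dots> \<ge> card ({..<n} - bad) - card {i}" by (intro diff_card_le_card_Diff) simp
    finally have "card ({..<n} - bad) - 1 \<le> card (J i)" by simp
    moreover have "card {..<n} - card bad \<le> card ({..<n} - bad)"
      by (intro diff_card_le_card_Diff) (auto simp: bad_def)
    ultimately show ?thesis using \<open>card bad \<le> card E\<close> by simp
  qed
  let ?B = "\<lambda>i. {\<omega> \<in> space M. (\<forall>e\<in>E. y < W e \<omega>) \<and> (\<forall>v\<in>J i. \<not> pivot l a (weights \<omega>) v)}"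
  have fin: "finite (J i)" for i by (simp add: J_def)
  have B_meas: "?B i \<in> events" for i
  proof -
    have [measurable]: "Measurable.pred M (\<lambda>\<omega>. \<forall>e\<in>E. y < W e \<omega>)"
      using heavy_edges_measurable[OF E(1) order_refl, of y] weight_algebra_events[OF E(2)]
      by (auto simp: pred_def)
    have [measurable]: "Measurable.pred M (\<lambda>\<omega>. \<forall>v\<in>J i. \<not> pivot l a (weights \<omega>) v)"
      using fin by (intro pred_intros_finite) measurable
    show ?thesis by measurable
  qed
  have "?A \<subseteq> (\<Union>i\<le>m. ?B i)"
  proof
    fix \<omega> assume \<omega>: "\<omega> \<in> ?A"
    show "\<omega> \<in> (\<Union>i\<le>m. ?B i)"
    proof (cases "\<exists>j<n. pivot l a (weights \<omega>) (g j)")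
      case True
      then obtain j where j: "j < n" "pivot l a (weights \<omega>) (g j)" by blast
      have "\<not> pivot l a (weights \<omega>) (g i)" if "i < n" "i \<noteq> j" for i
      proof -
        have "g i < g j \<or> g j < g i" using that inj_g by (metis injD linorder_neqE)
        moreover have "0 \<le> g i" "0 \<le> g j" by (auto simp: g_def)
        ultimately show ?thesis using \<omega> j g_less that by blast
      qed
      moreover have "n \<le> m" unfolding n_def by (rule div_le_dividend)
      ultimately show ?thesis using \<omega> j by (intro UN_I[of j]) (auto simp: J_def)
    next
      case False
      then show ?thesis using \<omega> by (intro UN_I[of 0]) (auto simp: J_def)
    qed
  qed
  then have "prob ?A \<le> prob (\<Union>i\<le>m. ?B i)" using B_meas by (intro finite_measure_mono) auto
  also have "\<dots> \<le> (\<Sum>i\<le>m. prob (?B i))"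
    using B_meas by (intro finite_measure_subadditive_finite) auto
  also have "\<dots> \<le> (\<Sum>i\<le>m. survival D y ^ card E * (1 - pivot_bound) ^ (n - (card E + 1)))"
  proof (rule sum_mono)
    fix i
    have "prob (?B i) \<le> survival D y ^ card E * (1 - pivot_bound) ^ card (J i)"
      by (rule prob_heavy_no_pivots[OF E fin]) (auto simp: J_def bad_def intro!: g_sep)
    also have "\<dots> \<le> survival D y ^ card E * (1 - pivot_bound) ^ (n - (card E + 1))"
      using pivot_bound card_J survival_bounds[OF law, of y]
      by (intro mult_left_mono power_decreasing) auto
    finally show "prob (?B i) \<le> survival D y ^ card E * (1 - pivot_bound) ^ (n - (card E + 1))" .
  qed
  finally show ?thesis by (simp add: n_def)
qed

end

section \<open>The first two pivots\<close>

text \<open>\<open>u\<close> and \<open>v\<close> only witness that two pivots exist, which makes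
  the two \<open>LEAST\<close> values behind \<open>enumerate\<close> genuine.\<close>

lemma rho_first_two:
  assumes "0 \<le> u" "u < v" "pivot l a w u" "pivot l a w v"
  shows "0 \<le> rho l a w 1" "rho l a w 1 < rho l a w 2"
    "pivot l a w (rho l a w 1)" "pivot l a w (rho l a w 2)"
    "\<And>z. 0 \<le> z \<Longrightarrow> z < rho l a w 2 \<Longrightarrow> pivot l a w z \<Longrightarrow> z = rho l a w 1"
proof -
  let ?P = "\<lambda>n. pivot l a w (int n)"
  define m where "m = (LEAST n. ?P n)"
  define n where "n = (LEAST n. ?P n \<and> n \<noteq> m)"
  have rho: "rho l a w 1 = int m" "rho l a w 2 = int n"
    by (simp_all add: rho_def enumerate_0 enumerate_Suc m_def n_def)
  have uv: "?P (nat u)" "?P (nat v)" using assms by auto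
  have m: "?P m" unfolding m_def by (rule LeastI[of ?P, OF uv(1)])
  have m_le: "m \<le> i" if "?P i" for i unfolding m_def using that by (rule Least_le)
  have "nat u \<noteq> nat v" using assms by auto
  then have ex: "\<exists>i. ?P i \<and> i \<noteq> m" using uv by metis
  have n: "?P n \<and> n \<noteq> m" unfolding n_def by (rule LeastI_ex[OF ex])
  have n_le: "n \<le> i" if "?P i" "i \<noteq> m" for i
    unfolding n_def using that by (intro Least_le) auto
  show "0 \<le> rho l a w 1" "pivot l a w (rho l a w 1)" "pivot l a w (rho l a w 2)"
    using m n by (simp_all add: rho del: One_nat_def)
  show "rho l a w 1 < rho l a w 2" using m_le[of n] n by (simp add: rho del: One_nat_def)
  fix z assume z: "0 \<le> z" "z < rho l a w 2" "pivot l a w z"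
  then show "z = rho l a w 1" using n_le[of "nat z"] by (fastforce simp: rho simp del: One_nat_def)
qed

text \<open>A Bonferroni inequality, with the number of pairs bounded by the square of the number of
  sets.\<close>

lemma (in finite_measure) measure_UN_ge:
  assumes "finite I" and "\<And>i. i \<in> I \<Longrightarrow> A i \<in> sets M"
    and "\<And>i j. i \<in> I \<Longrightarrow> j \<in> I \<Longrightarrow> i \<noteq> j \<Longrightarrow> measure M (A i \<inter> A j) \<le> \<epsilon>" and "0 \<le> \<epsilon>"
  shows "(\<Sum>i\<in>I. measure M (A i)) - real (card I * card I) * \<epsilon> \<le> measure M (\<Union>i\<in>I. A i)"
  using assms(1-3)
proof (induction I)
  case (insert i I)
  have A: "A j \<in> sets M" if "j \<in> insert i I" for j using insert.prems(1) that .
  have U: "(\<Union>j\<in>I. A j) \<in> sets M" using A insert.hyps by (intro sets.finite_UN) auto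
  have "measure M (A i \<inter> (\<Union>j\<in>I. A j)) = measure M (\<Union>j\<in>I. A i \<inter> A j)" by (simp only: Int_UN_distrib)
  also have "\<dots> \<le> (\<Sum>j\<in>I. measure M (A i \<inter> A j))"
    using A insert.hyps by (intro finite_measure_subadditive_finite) auto
  also have "\<dots> \<le> (\<Sum>j\<in>I. \<epsilon>)" using insert.prems(2)[of i] insert.hyps by (intro sum_mono) auto
  finally have inter: "measure M (A i \<inter> (\<Union>j\<in>I. A j)) \<le> real (card I) * \<epsilon>" by simp
  have "measure M (\<Union>j\<in>insert i I. A j) = measure M ((\<Union>j\<in>I. A j) \<union> A i)" by (simp add: Un_commute)
  also have "\<dots> = measure M (\<Union>j\<in>I. A j) + (measure M (A i) - measure M (A i \<inter> (\<Union>j\<in>I. A j)))"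
    using finite_measure_Union'[OF U A[of i]] finite_measure_Diff'[OF A[of i] U] by simp
  also have "\<dots> \<ge> (\<Sum>j\<in>I. measure M (A j)) - real (card I * card I) * \<epsilon> + (measure M (A i) - real (card I) * \<epsilon>)"
    using insert inter by (intro add_mono) auto
  finally have *: "(\<Sum>j\<in>insert i I. measure M (A j)) - (real (card I * card I) + real (card I)) * \<epsilon>
      \<le> measure M (\<Union>j\<in>insert i I. A j)"
    using insert.hyps by (simp add: algebra_simps)
  have "(real (card I * card I) + real (card I)) * \<epsilon> \<le> real (card (insert i I) * card (insert i I)) * \<epsilon>"
    using insert.hyps assms(4) by (intro mult_right_mono) (auto simp: algebra_simps)
  with * show ?case by linarith
qed simp

section \<open>Measurability, and the expected gap between the two pivots\<close>

context spread_out_fpp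
begin

definition first_pivot :: "'a \<Rightarrow> int" where
  "first_pivot \<omega> = rho l a (weights \<omega>) 1"

definition second_pivot :: "'a \<Rightarrow> int" where
  "second_pivot \<omega> = rho l a (weights \<omega>) 2"

abbreviation crossing_time :: "'a \<Rightarrow> ereal" where
  "crossing_time \<omega> \<equiv> passage_time l (weights \<omega>) (first_pivot \<omega>) (second_pivot \<omega>)"

lemma pivots_measurable [measurable]:
  "first_pivot \<in> measurable M (count_space UNIV)" "second_pivot \<in> measurable M (count_space UNIV)"
proof -
  have [measurable]: "(\<lambda>\<omega>. LEAST n. pivot l a (weights \<omega>) (int n)) \<in> measurable M (count_space UNIV)"
    by measurable
  have "first_pivot = (\<lambda>\<omega>. int (LEAST n. pivot l a (weights \<omega>) (int n)))"
    by (simp add: first_pivot_def rho_def enumerate_0 fun_eq_iff)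
  then show "first_pivot \<in> measurable M (count_space UNIV)" by simp
  have "second_pivot = (\<lambda>\<omega>. int (LEAST n. pivot l a (weights \<omega>) (int n) \<and>
      n \<noteq> (LEAST n. pivot l a (weights \<omega>) (int n))))"
    by (simp add: second_pivot_def rho_def enumerate_0 enumerate_Suc fun_eq_iff)
  then show "second_pivot \<in> measurable M (count_space UNIV)" by simp
qed

text \<open>Paths are lists of pairs of integers, so the infimum runs over a countable set.\<close>

lemma passage_time_measurable [measurable]:
  "(\<lambda>\<omega>. passage_time l (weights \<omega>) u v) \<in> borel_measurable M"
proof -
  have "(\<lambda>\<omega>. sum_list (map (arc_weight (weights \<omega>)) p)) \<in> borel_measurable M"
    if "set p \<subseteq> edges l \<union> (edges l)\<inverse>" for p
    using that
  proof (induction p)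
    case (Cons e p)
    then obtain e' where e': "e' \<in> edges l" "\<And>w. arc_weight w e = w e'"
      using arc_weight_edges[of e l] by auto
    note [measurable] = random_weight[OF e'(1)]
    have [measurable]: "(\<lambda>\<omega>. sum_list (map (arc_weight (weights \<omega>)) p)) \<in> borel_measurable M"
      using Cons by simp
    show ?case by (simp add: e'(2))
  qed simp
  then show ?thesis unfolding passage_time_def
    by (intro borel_measurable_INF borel_measurable_ereal) (auto dest: lattice_path_arcs)
qed

lemma crossing_time_event [measurable]: "Measurable.pred M (\<lambda>\<omega>. ereal x < crossing_time \<omega>)"
proof -
  have "(\<lambda>\<omega>. ereal x < crossing_time \<omega>) = (\<lambda>\<omega>. \<exists>u v. first_pivot \<omega> = u \<and> second_pivot \<omega> = v \<and>
      ereal x < passage_time l (weights \<omega>) u v)" by auto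
  also have "Measurable.pred M \<dots>" by measurable
  finally show ?thesis .
qed

text \<open>Once two pivots are known to exist this says that the second one is at least
  \<open>m\<close>. It avoids naming the pivots, so it can also serve to prove their
  existence.\<close>

definition few_pivots :: "nat \<Rightarrow> 'a \<Rightarrow> bool" where
  "few_pivots m \<omega> \<longleftrightarrow> (\<forall>u v. 0 \<le> u \<and> u < v \<and> v < int m \<longrightarrow>
     \<not> (pivot l a (weights \<omega>) u \<and> pivot l a (weights \<omega>) v))"

lemma few_pivots_measurable [measurable]: "Measurable.pred M (few_pivots m)"
proof -
  have "few_pivots m = (\<lambda>\<omega>. \<forall>u v. 0 \<le> u \<and> u < v \<and> v < int m \<longrightarrow>
     \<not> (pivot l a (weights \<omega>) u \<and> pivot l a (weights \<omega>) v))" by (auto simp: few_pivots_def)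
  then show ?thesis by simp
qed

lemma prob_few_pivots:
  "prob {\<omega> \<in> space M. few_pivots m \<omega>} \<le> real (m + 1) * (1 - pivot_bound) ^ (m div (l + 1) - 1)"
  using prob_heavy_few_pivots[of "{}" undefined m] by (simp add: few_pivots_def)

definition one_pivot :: "nat \<Rightarrow> 'a \<Rightarrow> bool" where
  "one_pivot m \<omega> \<longleftrightarrow> (\<exists>v\<in>{0..int m}. pivot l a (weights \<omega>) v \<and>
     (\<forall>u\<in>{0..int m}. pivot l a (weights \<omega>) u \<longrightarrow> u = v))"

text \<open>Vertices up to \<open>m\<close> have stars whose edges end before m + l, whereas the cut
  between m + l - 1 and m + l uses only edges that end at m + l or later. This gives exact
  independence of the two.\<close>

lemma one_pivot_measurable:
  assumes "{(x, y) \<in> edges l. y < int m + int l} \<subseteq> K"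
  shows "Measurable.pred (weight_algebra K) (one_pivot m)"
proof -
  have [measurable]: "Measurable.pred (weight_algebra K) (\<lambda>\<omega>. pivot l a (weights \<omega>) v)"
    if "v \<in> {0..int m}" for v
    by (rule pivot_measurable, rule order_trans[OF _ assms]) (use that in \<open>auto simp: star_def\<close>)
  have "Measurable.pred (weight_algebra K) (\<lambda>\<omega>. \<exists>v\<in>{0..int m}. pivot l a (weights \<omega>) v \<and>
     (\<forall>u\<in>{0..int m}. pivot l a (weights \<omega>) u \<longrightarrow> u = v))"
    by measurable
  then show ?thesis by (simp add: one_pivot_def[abs_def])
qed

lemma one_pivot_event [measurable]: "Measurable.pred M (one_pivot m)"
  using one_pivot_measurable[of m "edges l"] weight_algebra_events[of "edges l"]
  by (auto simp: pred_def)

lemma one_pivot_few_pivots: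
  assumes "one_pivot m \<omega>"
  shows "few_pivots (Suc m) \<omega>"
  unfolding few_pivots_def
proof (intro allI impI notI)
  obtain v where v: "\<forall>u\<in>{0..int m}. pivot l a (weights \<omega>) u \<longrightarrow> u = v"
    using assms unfolding one_pivot_def by blast
  fix u u' assume *: "0 \<le> u \<and> u < u' \<and> u' < int (Suc m)"
    "pivot l a (weights \<omega>) u \<and> pivot l a (weights \<omega>) u'"
  have "u = v" using v * by simp
  moreover have "u' = v" using v * by simp
  ultimately show False using * by simp
qed

definition one_pivot_prob :: "nat \<Rightarrow> real" where
  "one_pivot_prob m = prob {\<omega> \<in> space M. one_pivot m \<omega>}"

lemma one_pivot_prob_nonneg: "0 \<le> one_pivot_prob m"
  by (simp add: one_pivot_prob_def)

lemma summable_one_pivot_prob: "summable one_pivot_prob"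
proof (rule summable_comparison_test')
  have "summable (\<lambda>m. (real m + 2) ^ 1 * (1 - pivot_bound) ^ (m div (l + 1) - 1))"
    using pivot_bound by (intro summable_poly_geometric) auto
  then show "summable (\<lambda>m. (real (Suc m) + 2) * (1 - pivot_bound) ^ (Suc m div (l + 1) - 1))"
    by (subst summable_Suc_iff) simp
  fix m
  have "one_pivot_prob m \<le> prob {\<omega> \<in> space M. few_pivots (Suc m) \<omega>}"
    unfolding one_pivot_prob_def
    by (intro finite_measure_mono) (auto intro: one_pivot_few_pivots)
  also have "\<dots> \<le> real (Suc m + 1) * (1 - pivot_bound) ^ (Suc m div (l + 1) - 1)"
    by (rule prob_few_pivots)
  also have "\<dots> \<le> (real (Suc m) + 2) * (1 - pivot_bound) ^ (Suc m div (l + 1) - 1)"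
    using pivot_bound by (intro mult_right_mono) auto
  finally show "norm (one_pivot_prob m) \<le> (real (Suc m) + 2) * (1 - pivot_bound) ^ (Suc m div (l + 1) - 1)"
    using one_pivot_prob_nonneg[of m] by simp
qed

text \<open>The almost sure properties on which the pathwise arguments rest; they certify that the
  values of \<open>rho\<close> are the true first two pivots.\<close>

definition regular :: "'a \<Rightarrow> bool" where
  "regular \<omega> \<longleftrightarrow> (\<forall>e\<in>edges l. 0 \<le> W e \<omega>) \<and>
     0 \<le> first_pivot \<omega> \<and> first_pivot \<omega> < second_pivot \<omega> \<and>
     pivot l a (weights \<omega>) (first_pivot \<omega>) \<and> pivot l a (weights \<omega>) (second_pivot \<omega>) \<and>
     (\<forall>z. 0 \<le> z \<and> z < second_pivot \<omega> \<and> pivot l a (weights \<omega>) z \<longrightarrow> z = first_pivot \<omega>)"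

lemma AE_regular: "AE \<omega> in M. regular \<omega>"
proof -
  have "countable (edges l)" by (rule countable_subset[OF subset_UNIV]) simp
  moreover have "AE \<omega> in M. 0 \<le> W e \<omega>" if "e \<in> edges l" for e
    using AE_distrD[OF random_weight[OF that], unfolded distr_weight[OF that], OF law_nonneg] .
  ultimately have 1: "AE \<omega> in M. \<forall>e\<in>edges l. 0 \<le> W e \<omega>" by (simp add: AE_ball_countable)
  \<comment> \<open>The event of never seeing two pivots: it lies in every
    \<open>few_pivots m\<close>, and the probabilities of these tend to 0.\<close>
  have "prob {\<omega> \<in> space M. \<forall>m. few_pivots m \<omega>} \<le> 0"
  proof (rule LIMSEQ_le_const)
    have "summable (\<lambda>m. (real m + 2) ^ 1 * (1 - pivot_bound) ^ (m div (l + 1) - 1))"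
      using pivot_bound by (intro summable_poly_geometric) auto
    then show "(\<lambda>m. (real m + 2) * (1 - pivot_bound) ^ (m div (l + 1) - 1)) \<longlonglongrightarrow> 0"
      using summable_LIMSEQ_zero by fastforce
    have "prob {\<omega> \<in> space M. \<forall>m. few_pivots m \<omega>} \<le> (real m + 2) * (1 - pivot_bound) ^ (m div (l + 1) - 1)" for m
    proof -
      have "prob {\<omega> \<in> space M. \<forall>m. few_pivots m \<omega>} \<le> prob {\<omega> \<in> space M. few_pivots m \<omega>}"
        by (intro finite_measure_mono) auto
      also have "\<dots> \<le> real (m + 1) * (1 - pivot_bound) ^ (m div (l + 1) - 1)"
        by (rule prob_few_pivots)
      also have "\<dots> \<le> (real m + 2) * (1 - pivot_bound) ^ (m div (l + 1) - 1)"
        using pivot_bound by (intro mult_right_mono) auto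
      finally show ?thesis .
    qed
    then show "\<exists>N. \<forall>m\<ge>N. prob {\<omega> \<in> space M. \<forall>m. few_pivots m \<omega>} \<le> (real m + 2) * (1 - pivot_bound) ^ (m div (l + 1) - 1)"
      by blast
  qed
  then have "prob {\<omega> \<in> space M. \<forall>m. few_pivots m \<omega>} = 0" by (simp add: measure_le_0_iff)
  then have "AE \<omega> in M. \<not> (\<forall>m. few_pivots m \<omega>)"
    by (subst (asm) prob_Collect_eq_0) simp_all
  with 1 show ?thesis
  proof eventually_elim
    case (elim \<omega>)
    then obtain u v where "0 \<le> u" "u < v" "pivot l a (weights \<omega>) u" "pivot l a (weights \<omega>) v"
      unfolding few_pivots_def by blast
    from rho_first_two[OF this] elim(1) show ?case
      unfolding regular_def first_pivot_def second_pivot_def by blast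
  qed
qed

lemma one_pivot_iff:
  assumes "regular \<omega>"
  shows "one_pivot m \<omega> \<longleftrightarrow> first_pivot \<omega> \<le> int m \<and> int m < second_pivot \<omega>"
proof
  assume "one_pivot m \<omega>"
  then obtain v where v: "v \<in> {0..int m}" "pivot l a (weights \<omega>) v"
    "\<And>u. u \<in> {0..int m} \<Longrightarrow> pivot l a (weights \<omega>) u \<Longrightarrow> u = v"
    unfolding one_pivot_def by blast
  have r: "0 \<le> first_pivot \<omega>" "first_pivot \<omega> < second_pivot \<omega>"
    "pivot l a (weights \<omega>) (first_pivot \<omega>)" "pivot l a (weights \<omega>) (second_pivot \<omega>)"
    "\<And>z. 0 \<le> z \<Longrightarrow> z < second_pivot \<omega> \<Longrightarrow> pivot l a (weights \<omega>) z \<Longrightarrow> z = first_pivot \<omega>"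
    using assms unfolding regular_def by blast+
  have 1: "first_pivot \<omega> \<le> int m"
  proof (rule ccontr)
    assume "\<not> first_pivot \<omega> \<le> int m"
    then show False using r(5)[OF _ _ v(2)] r(2) v(1) by auto
  qed
  have "int m < second_pivot \<omega>"
  proof (rule ccontr)
    assume "\<not> int m < second_pivot \<omega>"
    then have "first_pivot \<omega> = v" "second_pivot \<omega> = v" using r(1-4) 1 by (simp_all add: v(3))
    then show False using r(2) by simp
  qed
  with 1 show "first_pivot \<omega> \<le> int m \<and> int m < second_pivot \<omega>" by simp
next
  assume "first_pivot \<omega> \<le> int m \<and> int m < second_pivot \<omega>"
  then show "one_pivot m \<omega>" using assms unfolding one_pivot_def regular_def
    by (intro bexI[of _ "first_pivot \<omega>"]) auto
qed

text \<open>On a regular configuration the \<open>m\<close> with \<open>one_pivot m\<close> are the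
  integers from the first pivot up to, but excluding, the second. Their indicators sum to the gap,
  and summable expectations permit the exchange of sum and integral.\<close>

lemma expectation_gap:
  "integrable M (\<lambda>\<omega>. real_of_int (second_pivot \<omega> - first_pivot \<omega>))" (is ?int)
  "one_pivot_prob sums expectation (\<lambda>\<omega>. real_of_int (second_pivot \<omega> - first_pivot \<omega>))" (is ?sums)
proof -
  let ?f = "\<lambda>m \<omega>. indicator {\<omega> \<in> space M. one_pivot m \<omega>} \<omega> :: real"
  have gap: "AE \<omega> in M. (\<lambda>m. ?f m \<omega>) sums real_of_int (second_pivot \<omega> - first_pivot \<omega>)"
    using AE_regular AE_space
  proof eventually_elim
    case (elim \<omega>)
    let ?r = "nat (first_pivot \<omega>)" and ?s = "nat (second_pivot \<omega>)"
    have "0 \<le> first_pivot \<omega>" "first_pivot \<omega> < second_pivot \<omega>" using elim by (auto simp: regular_def)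
    then have "?f m \<omega> = (if m \<in> {?r..<?s} then 1 else 0)" for m
      using elim one_pivot_iff[of \<omega> m] by (auto simp: indicator_def)
    moreover have "(\<lambda>m. if m \<in> {?r..<?s} then 1 else 0 :: real) sums (\<Sum>m\<in>{?r..<?s}. 1)"
      by (rule sums_If_finite_set) simp
    moreover have "(\<Sum>m\<in>{?r..<?s}. 1 :: real) = real_of_int (second_pivot \<omega> - first_pivot \<omega>)"
      using \<open>0 \<le> first_pivot \<omega>\<close> \<open>first_pivot \<omega> < second_pivot \<omega>\<close> by (simp add: of_nat_diff nat_mono)
    ultimately show ?case by simp
  qed
  have f: "integrable M (?f m)" for m by (intro integrable_real_indicator) (auto simp: emeasure_eq_measure)
  have prob_f: "expectation (?f m) = one_pivot_prob m" for m
    by (simp add: one_pivot_prob_def)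
  have AE: "AE \<omega> in M. summable (\<lambda>m. norm (?f m \<omega>))"
    using gap by eventually_elim (auto simp: sums_iff)
  have summable: "summable (\<lambda>m. \<integral>\<omega>. norm (?f m \<omega>) \<partial>M)"
    using summable_one_pivot_prob prob_f by simp
  have eq: "AE \<omega> in M. (\<Sum>m. ?f m \<omega>) = real_of_int (second_pivot \<omega> - first_pivot \<omega>)"
    using gap by eventually_elim (auto simp: sums_iff)
  show ?int
    using integrable_suminf[OF f AE summable] eq by (subst (asm) integrable_cong_AE) auto
  have "expectation (\<lambda>\<omega>. \<Sum>m. ?f m \<omega>) = expectation (\<lambda>\<omega>. real_of_int (second_pivot \<omega> - first_pivot \<omega>))"
    using eq by (intro integral_cong_AE) auto
  then show ?sums using sums_integral[OF f AE summable] prob_f by simp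
qed

section \<open>Lower bound: disjoint contributions of heavy straight cuts\<close>

lemma crossing_time_heavy_cut:
  assumes "regular \<omega>" "a \<le> x" "one_pivot m \<omega>"
    and heavy: "\<And>e. e \<in> cut_edges l (int m + int l - 1) \<Longrightarrow> x < W e \<omega>"
  shows "ereal x < crossing_time \<omega>"
proof (rule passage_time_gt)
  let ?k = "int m + int l - 1"
  have m: "first_pivot \<omega> \<le> int m" "int m < second_pivot \<omega>" using one_pivot_iff assms by auto
  then show "first_pivot \<omega> \<le> ?k" using range by simp
  \<comment> \<open>A second pivot between m + 1 and k would be within l - 1 of k + 1, so its edge
    to k + 1 would be light and yet belong to the heavy cut.\<close>
  show "?k < second_pivot \<omega>"
  proof (rule ccontr)
    assume "\<not> ?k < second_pivot \<omega>"
    moreover from this have "(second_pivot \<omega>, ?k + 1) \<in> cut_edges l ?k"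
      using m by (auto simp: cut_edges_def edges_def)
    moreover have "W (second_pivot \<omega>, ?k + 1) \<omega> < a"
      using assms(1) calculation m by (intro pivot_right[of l a "weights \<omega>"]) (auto simp: regular_def)
    ultimately show False using heavy \<open>a \<le> x\<close> by fastforce
  qed
qed (use assms heavy range in \<open>auto simp: regular_def\<close>)

lemma prob_heavy_cut:
  "prob {\<omega> \<in> space M. one_pivot m \<omega> \<and> (\<forall>e\<in>cut_edges l (int m + int l - 1). x < W e \<omega>)}
    = one_pivot_prob m * survival D x ^ (l * (l + 1) div 2)"
proof -
  let ?K = "{(x, y) \<in> edges l. y < int m + int l}" and ?C = "cut_edges l (int m + int l - 1)"
  have A: "{\<omega> \<in> space M. one_pivot m \<omega>} \<in> sets (weight_algebra ?K)"
    using one_pivot_measurable[OF order_refl] by (simp add: pred_weight_algebra)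
  have B: "{\<omega> \<in> space M. \<forall>e\<in>?C. x < W e \<omega>} \<in> sets (weight_algebra ?C)"
    using heavy_edges_measurable[OF finite_cut order_refl] by (simp add: pred_weight_algebra)
  have "prob ({\<omega> \<in> space M. one_pivot m \<omega>} \<inter> {\<omega> \<in> space M. \<forall>e\<in>?C. x < W e \<omega>}) =
      prob {\<omega> \<in> space M. one_pivot m \<omega>} * prob {\<omega> \<in> space M. \<forall>e\<in>?C. x < W e \<omega>}"
    by (rule indep_weight_algebras[OF _ _ _ A B]) (auto simp: cut_edges_def)
  also have "prob {\<omega> \<in> space M. \<forall>e\<in>?C. x < W e \<omega>} = survival D x ^ (l * (l + 1) div 2)"
    by (subst prob_heavy_edges) (auto simp: finite_cut card_cut, auto simp: cut_edges_def)
  finally show ?thesis by (simp add: one_pivot_prob_def Int_def conj_ac cong: conj_cong)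
qed

lemma heavy_edges_event:
  assumes "finite E" "E \<subseteq> edges l"
  shows "{\<omega> \<in> space M. \<forall>e\<in>E. y < W e \<omega>} \<in> events"
  using heavy_edges_measurable[OF assms(1) order_refl, of y] weight_algebra_events[OF assms(2)]
  by (auto simp: pred_def)

lemma heavy_cut_event:
  "{\<omega> \<in> space M. one_pivot m \<omega> \<and> (\<forall>e\<in>cut_edges l k. x < W e \<omega>)} \<in> events"
proof -
  have "{\<omega> \<in> space M. one_pivot m \<omega>} \<in> events" by measurable
  moreover have "{\<omega> \<in> space M. \<forall>e\<in>cut_edges l k. x < W e \<omega>} \<in> events"
    by (intro heavy_edges_event finite_cut) (auto simp: cut_edges_def)
  moreover have "{\<omega> \<in> space M. one_pivot m \<omega> \<and> (\<forall>e\<in>cut_edges l k. x < W e \<omega>)} =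
      {\<omega> \<in> space M. one_pivot m \<omega>} \<inter> {\<omega> \<in> space M. \<forall>e\<in>cut_edges l k. x < W e \<omega>}" by auto
  ultimately show ?thesis by (simp only: sets.Int)
qed

text \<open>The unit edge \<open>(i, i + 1)\<close> crosses the left cut but not the right one, so
  two heavy cuts need at least one edge more than a single one.\<close>

lemma prob_two_heavy_cuts:
  assumes "i < j"
  shows "prob {\<omega> \<in> space M. (\<forall>e\<in>cut_edges l i. x < W e \<omega>) \<and> (\<forall>e\<in>cut_edges l j. x < W e \<omega>)}
    \<le> survival D x ^ Suc (l * (l + 1) div 2)"
proof -
  let ?E = "insert (i, i + 1) (cut_edges l j)"
  have E: "finite ?E" "?E \<subseteq> edges l" and i: "(i, i + 1) \<in> cut_edges l i" "(i, i + 1) \<notin> cut_edges l j"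
    using finite_cut range assms by (auto simp: cut_edges_def edges_def)
  have "prob {\<omega> \<in> space M. (\<forall>e\<in>cut_edges l i. x < W e \<omega>) \<and> (\<forall>e\<in>cut_edges l j. x < W e \<omega>)}
      \<le> prob {\<omega> \<in> space M. \<forall>e\<in>?E. x < W e \<omega>}"
    by (intro finite_measure_mono heavy_edges_event E) (use i(1) in auto)
  also have "\<dots> = survival D x ^ Suc (l * (l + 1) div 2)"
    using prob_heavy_edges[OF E] i(2) finite_cut card_cut by simp
  finally show ?thesis .
qed

text \<open>For fixed \<open>n\<close> the overlaps in the Bonferroni bound carry an additional
  factor of the tail and vanish after normalisation.\<close>

lemma crossing_prob_ge:
  assumes "a \<le> x"
  shows "(\<Sum>m<n. one_pivot_prob m) * survival D x ^ (l * (l + 1) div 2)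
      - real (n * n) * survival D x ^ Suc (l * (l + 1) div 2)
    \<le> prob {\<omega> \<in> space M. ereal x < crossing_time \<omega>}"
proof -
  let ?A = "\<lambda>m. {\<omega> \<in> space M. one_pivot m \<omega> \<and> (\<forall>e\<in>cut_edges l (int m + int l - 1). x < W e \<omega>)}"
  have C: "{\<omega> \<in> space M. \<forall>e\<in>cut_edges l k. x < W e \<omega>} \<in> events" for k
    by (intro heavy_edges_event finite_cut) (auto simp: cut_edges_def)
  have pair: "prob (?A i \<inter> ?A j) \<le> survival D x ^ Suc (l * (l + 1) div 2)" if "i < j" for i j
  proof -
    have "prob (?A i \<inter> ?A j) \<le> prob ({\<omega> \<in> space M. \<forall>e\<in>cut_edges l (int i + int l - 1). x < W e \<omega>} \<inter>
        {\<omega> \<in> space M. \<forall>e\<in>cut_edges l (int j + int l - 1). x < W e \<omega>})"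
      using C by (intro finite_measure_mono sets.Int) auto
    also have "\<dots> = prob {\<omega> \<in> space M. (\<forall>e\<in>cut_edges l (int i + int l - 1). x < W e \<omega>) \<and>
        (\<forall>e\<in>cut_edges l (int j + int l - 1). x < W e \<omega>)}"
      by (intro arg_cong[of _ _ prob]) auto
    also have "\<dots> \<le> survival D x ^ Suc (l * (l + 1) div 2)"
      using that by (intro prob_two_heavy_cuts) simp
    finally show ?thesis .
  qed
  have "(\<Sum>m<n. prob (?A m)) - real (card {..<n} * card {..<n}) * survival D x ^ Suc (l * (l + 1) div 2)
      \<le> prob (\<Union>m<n. ?A m)"
  proof (rule measure_UN_ge)
    fix i j :: nat assume "i \<noteq> j"
    then show "prob (?A i \<inter> ?A j) \<le> survival D x ^ Suc (l * (l + 1) div 2)"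
      using pair[of i j] pair[of j i] by (cases "i < j") (auto simp: Int_commute)
  qed (use heavy_cut_event survival_bounds[OF law, of x] in auto)
  also have "\<dots> \<le> prob {\<omega> \<in> space M. ereal x < crossing_time \<omega>}"
  proof (rule finite_measure_mono_AE)
    show "AE \<omega> in M. \<omega> \<in> (\<Union>m<n. ?A m) \<longrightarrow> \<omega> \<in> {\<omega> \<in> space M. ereal x < crossing_time \<omega>}"
      using AE_regular
      by eventually_elim (use crossing_time_heavy_cut assms in auto)
  qed measurable
  finally show ?thesis by (simp only: prob_heavy_cut sum_distrib_right card_lessThan)
qed

end

section \<open>Upper bounds and the limit\<close>

context spread_out_fpp
begin

definition edge_box :: "nat \<Rightarrow> (int \<times> int) set" where
  "edge_box n = edges l \<inter> {0..int n} \<times> {0..int n}"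

lemma finite_edge_box: "finite (edge_box n)"
  unfolding edge_box_def by (rule finite_edges_between)

lemma card_edge_box: "card (edge_box n) \<le> (n + 1) ^ 2"
proof -
  have "card (edge_box n) \<le> card ({0..int n} \<times> {0..int n})"
    unfolding edge_box_def by (intro card_mono) auto
  also have "\<dots> = (n + 1) ^ 2"
    by (simp add: card_cartesian_product power2_eq_square nat_add_distrib)
  finally show ?thesis .
qed

lemma edge_box_subset: "E \<subseteq> edge_box n \<Longrightarrow> E \<subseteq> edges l"
  by (auto simp: edge_box_def)

text \<open>Either the edges above \<open>y\<close> are at most as many as a straight cut has, and
  \<open>heavy_cut\<close> applies, or one more than that can be picked, at the price of an extra
  factor of the tail.\<close>

lemma crossing_time_cases:
  assumes reg: "regular \<omega>" and "a \<le> y" "a \<le> z"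
    and T: "ereal (z + real n * y) < crossing_time \<omega>" and n: "second_pivot \<omega> \<le> int n"
  shows "(\<exists>m<n. one_pivot m \<omega> \<and> (\<forall>e\<in>cut_edges l (int m + int l - 1). z < W e \<omega>)) \<or>
    (\<exists>E\<subseteq>edge_box n. card E = Suc (l * (l + 1) div 2) \<and> (\<forall>e\<in>E. y < W e \<omega>))"
proof -
  let ?u = "first_pivot \<omega>" and ?v = "second_pivot \<omega>"
  let ?H = "{e \<in> edges l \<inter> {?u..?v} \<times> {?u..?v}. y < W e \<omega>}"
  have uv: "0 \<le> ?u" "?u < ?v" and piv: "pivot l a (weights \<omega>) ?u" "pivot l a (weights \<omega>) ?v"
    using reg unfolding regular_def by blast+
  show ?thesis
  proof (cases "card ?H \<le> l * (l + 1) div 2")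
    case True
    have "z + real_of_int (?v - ?u) * y \<le> z + real n * y"
      using uv n a_pos assms by (intro add_left_mono mult_right_mono) auto
    then have "ereal (z + real_of_int (?v - ?u) * y) < crossing_time \<omega>"
      using T by (meson ereal_less_eq(3) order_le_less_trans)
    moreover have "0 \<le> z" using a_pos \<open>a \<le> z\<close> by simp
    ultimately obtain k where k: "?u \<le> k" "k < ?v" "\<And>e. e \<in> cut_edges l k \<Longrightarrow> z < W e \<omega>"
      using heavy_cut[OF range a_pos piv uv(2) \<open>a \<le> y\<close> _ _ True] by blast
    \<comment> \<open>A first pivot within l - 1 of k + 1 would have a light edge in the cut. Hence
      m = k - l + 1 has not fallen below the first pivot, and \<open>one_pivot m\<close>
      holds.\<close>
    have "?u \<le> k - int l + 1"
    proof (rule ccontr)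
      assume "\<not> ?thesis"
      then have "W (?u, k + 1) \<omega> < a" "(?u, k + 1) \<in> cut_edges l k"
        using piv k by (auto intro!: pivot_right[of l a "weights \<omega>"] simp: cut_edges_def edges_def)
      then show False using k(3) \<open>a \<le> z\<close> by fastforce
    qed
    then have "one_pivot (nat (k - int l + 1)) \<omega>" "nat (k - int l + 1) < n"
      using one_pivot_iff[OF reg, of "nat (k - int l + 1)"] uv k(2) n range by auto
    moreover have "int (nat (k - int l + 1)) + int l - 1 = k"
      using \<open>?u \<le> k - int l + 1\<close> uv by simp
    ultimately show ?thesis using k(3) by metis
  next
    case False
    then have "Suc (l * (l + 1) div 2) \<le> card ?H" by simp
    then obtain E where "E \<subseteq> ?H" "card E = Suc (l * (l + 1) div 2)"
      by (rule obtain_subset_with_card_n)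
    moreover have "?H \<subseteq> edge_box n" using uv n by (auto simp: edge_box_def)
    ultimately have "E \<subseteq> edge_box n \<and> card E = Suc (l * (l + 1) div 2) \<and> (\<forall>e\<in>E. y < W e \<omega>)" by blast
    then show ?thesis by blast
  qed
qed

lemma crossing_prob_near_le:
  assumes "a \<le> y" "a \<le> z"
  shows "prob {\<omega> \<in> space M. ereal (z + real n * y) < crossing_time \<omega> \<and> second_pivot \<omega> \<le> int n}
    \<le> (\<Sum>m<n. one_pivot_prob m) * survival D z ^ (l * (l + 1) div 2) +
      real (card (edge_box n) choose Suc (l * (l + 1) div 2)) * survival D y ^ Suc (l * (l + 1) div 2)"
proof -
  let ?lc = "l * (l + 1) div 2"
  let ?A = "\<lambda>m. {\<omega> \<in> space M. one_pivot m \<omega> \<and> (\<forall>e\<in>cut_edges l (int m + int l - 1). z < W e \<omega>)}"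
  let ?F = "{E. E \<subseteq> edge_box n \<and> card E = Suc ?lc}"
  let ?B = "\<lambda>E. {\<omega> \<in> space M. \<forall>e\<in>E. y < W e \<omega>}"
  have A: "?A m \<in> events" for m by (rule heavy_cut_event)
  have fin: "finite ?F" using finite_edge_box by simp
  have E: "finite E" "E \<subseteq> edges l" if "E \<in> ?F" for E
    using that finite_edge_box finite_subset edge_box_subset by blast+
  have B: "?B E \<in> events" if "E \<in> ?F" for E
    using E[OF that] by (rule heavy_edges_event)
  have UA: "(\<Union>m<n. ?A m) \<in> events" using A by auto
  have UB: "(\<Union>E\<in>?F. ?B E) \<in> events" using B fin by (intro sets.finite_UN) auto
  have "prob {\<omega> \<in> space M. ereal (z + real n * y) < crossing_time \<omega> \<and> second_pivot \<omega> \<le> int n}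
    \<le> prob ((\<Union>m<n. ?A m) \<union> (\<Union>E\<in>?F. ?B E))"
  proof (rule finite_measure_mono_AE)
    show "AE \<omega> in M. \<omega> \<in> {\<omega> \<in> space M. ereal (z + real n * y) < crossing_time \<omega> \<and> second_pivot \<omega> \<le> int n}
        \<longrightarrow> \<omega> \<in> (\<Union>m<n. ?A m) \<union> (\<Union>E\<in>?F. ?B E)"
      using AE_regular
    proof eventually_elim
      case (elim \<omega>)
      show ?case using crossing_time_cases[OF elim assms, of n] by auto
    qed
  qed (use UA UB in auto)
  also have "\<dots> \<le> prob (\<Union>m<n. ?A m) + prob (\<Union>E\<in>?F. ?B E)"
    using UA UB by (rule measure_Un_le)
  also have "prob (\<Union>m<n. ?A m) \<le> (\<Sum>m<n. prob (?A m))"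
    using A by (intro finite_measure_subadditive_finite) auto
  also have "prob (\<Union>E\<in>?F. ?B E) \<le> (\<Sum>E\<in>?F. prob (?B E))"
    using fin B by (intro finite_measure_subadditive_finite) auto
  also have "\<dots> = (\<Sum>E\<in>?F. survival D y ^ Suc ?lc)"
    using E by (intro sum.cong refl) (subst prob_heavy_edges, auto)
  also have "\<dots> = real (card (edge_box n) choose Suc ?lc) * survival D y ^ Suc ?lc"
    using n_subsets[OF finite_edge_box, of n "Suc ?lc"] by simp
  finally show ?thesis by (simp only: prob_heavy_cut sum_distrib_right)
qed

end

section \<open>Distant second pivots and the passage to the limit\<close>

locale spread_out_fpp_regular_tail = spread_out_fpp M W D l a + regular_tail D \<gamma> L
  for M :: "'a measure" and W D l a \<gamma> L
begin

text \<open>For \<open>y\<close> = x / m, a path between the pivots can afford \<open>y\<close> per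
  edge, so at least \<open>lc\<close> edges exceed \<open>y\<close> while pivots below
  \<open>m\<close> are scarce; the two costs multiply. Dividing by \<open>survival D a\<close> makes
  the last factor at least 1 when y < a, so one bound covers both regimes.\<close>

lemma crossing_prob_at_le:
  assumes "0 < x" "1 \<le> m"
  shows "prob {\<omega> \<in> space M. ereal x < crossing_time \<omega> \<and> second_pivot \<omega> = int m}
    \<le> (real m + 2) ^ (2 * (l * (l + 1) div 2) + 1) *
      (1 - pivot_bound) ^ (m div (l + 1) - (l * (l + 1) div 2 + 1)) *
      (survival D (x / real m) / survival D a) ^ (l * (l + 1) div 2)"
    (is "prob ?X \<le> _")
proof -
  define lc where "lc = l * (l + 1) div 2"
  define q where "q = 1 - pivot_bound"
  define y where "y = x / real m"
  have q: "0 \<le> q" "q \<le> 1" using pivot_bound by (auto simp: q_def)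
  have few: "few_pivots m \<omega>" if "regular \<omega>" "second_pivot \<omega> = int m" for \<omega>
    unfolding few_pivots_def
  proof (intro allI impI notI)
    fix u v assume "0 \<le> u \<and> u < v \<and> v < int m" "pivot l a (weights \<omega>) u \<and> pivot l a (weights \<omega>) v"
    then have "u = first_pivot \<omega>" "v = first_pivot \<omega>" "u < v"
      using that unfolding regular_def by (metis order_less_trans order_le_less_trans less_imp_le)+
    then show False by simp
  qed
  have "prob ?X \<le> (real m + 2) ^ (2 * lc + 1) * q ^ (m div (l + 1) - (lc + 1)) * (survival D y / survival D a) ^ lc"
  proof (cases "a \<le> y")
    \<comment> \<open>If \<^term>\<open>y < a\<close>, the light edges at the pivots need not be below \<^term>\<open>y\<close>, but then \<^term>\<open>m\<close> is so
      large compared with \<^term>\<open>x\<close> that the scarcity of pivots alone suffices.\<close>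
    case True
    let ?F = "{E. E \<subseteq> edge_box m \<and> card E = lc}"
    let ?B = "\<lambda>E. {\<omega> \<in> space M. (\<forall>e\<in>E. y < W e \<omega>) \<and> few_pivots m \<omega>}"
    have fin: "finite ?F" using finite_edge_box by simp
    have E: "finite E" "E \<subseteq> edges l" if "E \<in> ?F" for E
      using that finite_edge_box finite_subset edge_box_subset by blast+
    have B: "?B E \<in> events" if "E \<in> ?F" for E
    proof -
      have "{\<omega> \<in> space M. few_pivots m \<omega>} \<in> events" by measurable
      moreover have "?B E = {\<omega> \<in> space M. \<forall>e\<in>E. y < W e \<omega>} \<inter> {\<omega> \<in> space M. few_pivots m \<omega>}" by auto
      ultimately show ?thesis using heavy_edges_event[OF E[OF that]] by (simp only: sets.Int)
    qed
    have "prob ?X \<le> prob (\<Union>E\<in>?F. ?B E)"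
    proof (rule finite_measure_mono_AE)
      show "AE \<omega> in M. \<omega> \<in> ?X \<longrightarrow> \<omega> \<in> (\<Union>E\<in>?F. ?B E)"
        using AE_regular
      proof (eventually_elim, intro impI)
        fix \<omega> assume reg: "regular \<omega>" and \<omega>: "\<omega> \<in> ?X"
        let ?u = "first_pivot \<omega>" and ?v = "second_pivot \<omega>"
        have uv: "0 \<le> ?u" "?u < ?v" and piv: "pivot l a (weights \<omega>) ?u" "pivot l a (weights \<omega>) ?v"
          using reg unfolding regular_def by blast+
        have "real_of_int (?v - ?u) * y \<le> real m * y"
          using uv \<omega> a_pos True by (intro mult_right_mono) auto
        also have "\<dots> = x" using assms by (simp add: y_def)
        finally have "ereal (real_of_int (?v - ?u) * y) \<le> ereal x" by simp
        also have "\<dots> < crossing_time \<omega>" using \<omega> by blast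
        finally obtain E where "E \<subseteq> edges l \<inter> {?u..?v} \<times> {?u..?v}" "card E = lc" "\<forall>e\<in>E. y < W e \<omega>"
          using many_heavy_edges[OF range a_pos piv uv(2) True] unfolding lc_def by blast
        moreover have "edges l \<inter> {?u..?v} \<times> {?u..?v} \<subseteq> edge_box m" using uv \<omega> by (auto simp: edge_box_def)
        ultimately have "E \<in> ?F" "\<omega> \<in> ?B E" using \<omega> few reg by auto
        then show "\<omega> \<in> (\<Union>E\<in>?F. ?B E)" by blast
      qed
    qed (use B fin in auto)
    also have "\<dots> \<le> (\<Sum>E\<in>?F. prob (?B E))"
      using fin B by (intro finite_measure_subadditive_finite) auto
    also have "\<dots> \<le> (\<Sum>E\<in>?F. real (m + 1) * survival D y ^ lc * q ^ (m div (l + 1) - (lc + 1)))"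
    proof (rule sum_mono)
      fix E assume "E \<in> ?F"
      then show "prob (?B E) \<le> real (m + 1) * survival D y ^ lc * q ^ (m div (l + 1) - (lc + 1))"
        using prob_heavy_few_pivots[OF E[OF \<open>E \<in> ?F\<close>], of y m] by (simp add: few_pivots_def q_def)
    qed
    also have "\<dots> = real (card (edge_box m) choose lc) * (real (m + 1) * survival D y ^ lc * q ^ (m div (l + 1) - (lc + 1)))"
      using n_subsets[OF finite_edge_box, of m lc] by simp
    \<comment> \<open>Counts the choices of \<open>lc\<close> edges among the at most (m + 1)^2
      edges of the box.\<close>
    also have "\<dots> \<le> (real m + 2) ^ (2 * lc) * ((real m + 2) * survival D y ^ lc * q ^ (m div (l + 1) - (lc + 1)))"
    proof (intro mult_mono order_refl)
      have "card (edge_box m) choose lc \<le> card (edge_box m) ^ lc"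
        by (cases "lc \<le> card (edge_box m)") (auto simp: binomial_le_pow binomial_eq_0)
      also have "\<dots> \<le> ((m + 1) ^ 2) ^ lc" using card_edge_box by (intro power_mono) auto
      also have "\<dots> \<le> ((m + 2) ^ 2) ^ lc" by (intro power_mono) auto
      finally have "real (card (edge_box m) choose lc) \<le> real (((m + 2) ^ 2) ^ lc)" by (rule of_nat_mono)
      also have "\<dots> = (real m + 2) ^ (2 * lc)" by (simp add: power_mult add.commute)
      finally show "real (card (edge_box m) choose lc) \<le> (real m + 2) ^ (2 * lc)" .
    qed (use q survival_bounds[OF law] in auto)
    also have "\<dots> = (real m + 2) ^ (2 * lc + 1) * q ^ (m div (l + 1) - (lc + 1)) * survival D y ^ lc"
      by (simp add: mult_ac)
    also have "\<dots> \<le> (real m + 2) ^ (2 * lc + 1) * q ^ (m div (l + 1) - (lc + 1)) * (survival D y / survival D a) ^ lc"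
    proof (intro mult_left_mono power_mono)
      have "survival D y * survival D a \<le> survival D y * 1"
        using survival_bounds[OF law] by (intro mult_left_mono) auto
      then show "survival D y \<le> survival D y / survival D a"
        using survival_pos[of a] by (simp add: field_simps)
    qed (use q survival_bounds[OF law] in auto)
    finally show ?thesis .
  next
    case False
    have "prob ?X \<le> prob {\<omega> \<in> space M. few_pivots m \<omega>}"
    proof (rule finite_measure_mono_AE)
      show "AE \<omega> in M. \<omega> \<in> ?X \<longrightarrow> \<omega> \<in> {\<omega> \<in> space M. few_pivots m \<omega>}"
        using AE_regular by eventually_elim (use few in auto)
    qed measurable
    also have "\<dots> \<le> real (m + 1) * q ^ (m div (l + 1) - 1)"
      unfolding q_def by (rule prob_few_pivots)
    also have "\<dots> \<le> (real m + 2) ^ (2 * lc + 1) * q ^ (m div (l + 1) - (lc + 1))"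
    proof (intro mult_mono power_decreasing)
      have "real (m + 1) \<le> (real m + 2) ^ 1" by simp
      also have "\<dots> \<le> (real m + 2) ^ (2 * lc + 1)" by (intro power_increasing) auto
      finally show "real (m + 1) \<le> (real m + 2) ^ (2 * lc + 1)" .
    qed (use q in auto)
    also have "\<dots> \<le> (real m + 2) ^ (2 * lc + 1) * q ^ (m div (l + 1) - (lc + 1)) * (survival D y / survival D a) ^ lc"
    proof -
      have "1 \<le> survival D y / survival D a"
        using survival_antimono[OF law, of y a] False survival_pos[of a] by simp
      then have "1 \<le> (survival D y / survival D a) ^ lc" by (rule one_le_power)
      then have "(real m + 2) ^ (2 * lc + 1) * q ^ (m div (l + 1) - (lc + 1)) * 1 \<le>
          (real m + 2) ^ (2 * lc + 1) * q ^ (m div (l + 1) - (lc + 1)) * (survival D y / survival D a) ^ lc"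
        using q by (intro mult_left_mono) auto
      then show ?thesis by simp
    qed
    finally show ?thesis .
  qed
  then show ?thesis by (simp add: lc_def q_def y_def)
qed

text \<open>The domination by \<open>h\<close> is uniform in \<open>x\<close>, which allows the
  truncation level to be fixed before \<open>x\<close> tends to infinity.\<close>

lemma crossing_prob_far_le:
  "\<exists>h. summable h \<and> (\<forall>x>0. \<forall>m\<ge>1.
     prob {\<omega> \<in> space M. ereal x < crossing_time \<omega> \<and> second_pivot \<omega> = int m}
       \<le> h m * survival D x ^ (l * (l + 1) div 2))"
proof -
  define lc where "lc = l * (l + 1) div 2"
  obtain A :: nat where A: "\<And>x m. 0 \<le> x \<Longrightarrow> 1 \<le> m \<Longrightarrow> survival D (x / m) \<le> (2 * m) ^ A * survival D x"
    using survival_divide by blast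
  \<comment> \<open>Exponent of m + 2: twice \<open>lc\<close> for choosing the edges, 1 for the
    grid point that may be a pivot, and \<open>A\<close> for each of the \<open>lc\<close> tails
    moved from x / m to x.\<close>
  define h where "h m = (2 ^ A / survival D a) ^ lc *
      ((real m + 2) ^ (2 * lc + 1 + A * lc) * (1 - pivot_bound) ^ (m div (l + 1) - (lc + 1)))" for m
  have "summable h"
    unfolding h_def using pivot_bound by (intro summable_mult summable_poly_geometric) auto
  moreover have "prob {\<omega> \<in> space M. ereal x < crossing_time \<omega> \<and> second_pivot \<omega> = int m}
      \<le> h m * survival D x ^ lc" if "0 < x" "1 \<le> m" for x m
  proof -
    let ?c = "(real m + 2) ^ (2 * lc + 1) * (1 - pivot_bound) ^ (m div (l + 1) - (lc + 1))"
    have "survival D (x / real m) \<le> (2 * real m) ^ A * survival D x"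
      using that by (intro A) auto
    also have "\<dots> \<le> (2 * (real m + 2)) ^ A * survival D x"
      using survival_bounds[OF law] by (intro mult_right_mono power_mono) auto
    finally have "survival D (x / real m) / survival D a \<le> (2 * (real m + 2)) ^ A * survival D x / survival D a"
      by (rule divide_right_mono) (rule survival_bounds[OF law])
    also have "\<dots> = (2 ^ A / survival D a) * (real m + 2) ^ A * survival D x"
      by (simp only: power_mult_distrib times_divide_eq_left times_divide_eq_right)
    finally have "survival D (x / real m) / survival D a \<le>
        (2 ^ A / survival D a) * (real m + 2) ^ A * survival D x" .
    then have "(survival D (x / real m) / survival D a) ^ lc \<le>
        ((2 ^ A / survival D a) * (real m + 2) ^ A * survival D x) ^ lc"
      using survival_bounds[OF law] by (intro power_mono) auto
    then have "?c * (survival D (x / real m) / survival D a) ^ lc \<le>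
        ?c * ((2 ^ A / survival D a) * (real m + 2) ^ A * survival D x) ^ lc"
      using pivot_bound by (intro mult_left_mono) auto
    also have "\<dots> = h m * survival D x ^ lc"
      unfolding h_def power_add power_mult[of "real m + 2" A lc] power_mult_distrib
      by (simp only: mult_ac)
    finally show ?thesis using crossing_prob_at_le[OF that] by (simp add: lc_def)
  qed
  ultimately show ?thesis unfolding lc_def by blast
qed

text \<open>The terms stand for a heavy straight cut, a surplus edge above \<open>y\<close>, and a
  second pivot beyond \<open>n\<close>. The last sum starts at \<open>Suc n\<close> because the near
  part includes \<open>n\<close>.\<close>

lemma crossing_prob_le:
  assumes h: "summable h" "\<And>x m. 0 < x \<Longrightarrow> 1 \<le> m \<Longrightarrow>
     prob {\<omega> \<in> space M. ereal x < crossing_time \<omega> \<and> second_pivot \<omega> = int m}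
       \<le> h m * survival D x ^ (l * (l + 1) div 2)"
    and "a \<le> y" "a \<le> z" and x: "x = z + real n * y"
  shows "prob {\<omega> \<in> space M. ereal x < crossing_time \<omega>}
    \<le> (\<Sum>m<n. one_pivot_prob m) * survival D z ^ (l * (l + 1) div 2) +
      real (card (edge_box n) choose Suc (l * (l + 1) div 2)) * survival D y ^ Suc (l * (l + 1) div 2) +
      (\<Sum>i. h (i + Suc n)) * survival D x ^ (l * (l + 1) div 2)"
proof -
  let ?S = "survival D x ^ (l * (l + 1) div 2)"
  let ?N = "{\<omega> \<in> space M. ereal x < crossing_time \<omega> \<and> second_pivot \<omega> \<le> int n}"
  let ?R = "\<lambda>i. {\<omega> \<in> space M. ereal x < crossing_time \<omega> \<and> second_pivot \<omega> = int (i + Suc n)}"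
  have "0 < x" using a_pos assms by (simp add: add_pos_nonneg)
  have N: "?N \<in> events" by measurable
  have R: "?R i \<in> events" for i by measurable
  have h': "summable (\<lambda>i. h (i + Suc n) * ?S)"
    using h(1) by (intro summable_mult2) (simp only: summable_iff_shift)
  have R_le: "prob (?R i) \<le> h (i + Suc n) * ?S" for i
    using \<open>0 < x\<close> by (intro h(2)) auto
  have R_summable: "summable (\<lambda>i. prob (?R i))"
    by (rule summable_comparison_test'[OF h', of 0]) (use R_le in auto)
  have "prob {\<omega> \<in> space M. ereal x < crossing_time \<omega>} \<le> prob (?N \<union> (\<Union>i. ?R i))"
  proof (intro finite_measure_mono subsetI)
    fix \<omega> assume \<omega>: "\<omega> \<in> {\<omega> \<in> space M. ereal x < crossing_time \<omega>}"
    show "\<omega> \<in> ?N \<union> (\<Union>i. ?R i)"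
    proof (cases "second_pivot \<omega> \<le> int n")
      case False
      then have "second_pivot \<omega> = int (nat (second_pivot \<omega> - int (Suc n)) + Suc n)" by simp
      then show ?thesis using \<omega> by blast
    qed (use \<omega> in auto)
  qed (use N R in auto)
  also have "\<dots> \<le> prob ?N + prob (\<Union>i. ?R i)"
    using N R by (intro measure_Un_le) auto
  also have "prob (\<Union>i. ?R i) \<le> (\<Sum>i. prob (?R i))"
    using R R_summable by (intro finite_measure_subadditive_countably) auto
  also have "\<dots> \<le> (\<Sum>i. h (i + Suc n) * ?S)"
    using R_le R_summable h' by (intro suminf_le) auto
  also have "\<dots> = (\<Sum>i. h (i + Suc n)) * ?S"
    using h(1) by (intro suminf_mult2[symmetric]) (simp only: summable_iff_shift)
  also have "prob ?N \<le> (\<Sum>m<n. one_pivot_prob m) * survival D z ^ (l * (l + 1) div 2) +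
      real (card (edge_box n) choose Suc (l * (l + 1) div 2)) * survival D y ^ Suc (l * (l + 1) div 2)"
    unfolding x by (rule crossing_prob_near_le) fact+
  finally show ?thesis by simp
qed

text \<open>For the upper bound, \<open>n\<close> first makes the far part smaller than (u - E) / 2,
  then \<open>s\<close> close to 1 keeps the loss in the main term below (u - E) / 2, and only then
  does \<open>x\<close> grow. For the lower bound only \<open>n\<close> has to be chosen.\<close>

lemma crossing_prob_limit:
  "((\<lambda>x. prob {\<omega> \<in> space M. ereal x < crossing_time \<omega>} / survival D x ^ (l * (l + 1) div 2))
    \<longlongrightarrow> expectation (\<lambda>\<omega>. real_of_int (second_pivot \<omega> - first_pivot \<omega>))) at_top"
proof (rule order_tendstoI)
  define lc where "lc = l * (l + 1) div 2"
  define E where "E = expectation (\<lambda>\<omega>. real_of_int (second_pivot \<omega> - first_pivot \<omega>))"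
  let ?P = "\<lambda>x. prob {\<omega> \<in> space M. ereal x < crossing_time \<omega>}"
  have sums: "one_pivot_prob sums E" unfolding E_def by (rule expectation_gap)
  have S0: "(survival D \<longlongrightarrow> 0) at_top" by (rule survival_tendsto_0[OF law])
  have S: "0 < survival D x" for x by (rule survival_pos)
  {
    fix u assume "u < E"
    then have "\<forall>\<^sub>F n in sequentially. u < (\<Sum>m<n. one_pivot_prob m)"
      using sums unfolding sums_def by (intro order_tendstoD)
    then obtain n where n: "u < (\<Sum>m<n. one_pivot_prob m)"
      by (auto simp: eventually_sequentially)
    have "((\<lambda>x. (\<Sum>m<n. one_pivot_prob m) - real (n * n) * survival D x) \<longlongrightarrow>
        (\<Sum>m<n. one_pivot_prob m) - real (n * n) * 0) at_top"
      by (intro tendsto_intros S0)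
    then have "\<forall>\<^sub>F x in at_top. u < (\<Sum>m<n. one_pivot_prob m) - real (n * n) * survival D x"
      using n by (intro order_tendstoD(1)) auto
    then show "\<forall>\<^sub>F x in at_top. u < ?P x / survival D x ^ lc"
      using eventually_ge_at_top[of a]
    proof eventually_elim
      case (elim x)
      have "(\<Sum>m<n. one_pivot_prob m) - real (n * n) * survival D x \<le> ?P x / survival D x ^ lc"
        using crossing_prob_ge[OF elim(2), of n, folded lc_def] S[of x] by (simp add: field_simps)
      with elim show ?case by simp
    qed
  next
    fix u assume "E < u"
    obtain h where h: "summable h" "\<And>x m. 0 < x \<Longrightarrow> 1 \<le> m \<Longrightarrow>
        prob {\<omega> \<in> space M. ereal x < crossing_time \<omega> \<and> second_pivot \<omega> = int m} \<le> h m * survival D x ^ lc"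
      using crossing_prob_far_le unfolding lc_def by blast
    obtain N where N: "\<And>n. N \<le> n \<Longrightarrow> norm (\<Sum>i. h (i + n)) < (u - E) / 2"
      using suminf_exist_split[OF _ h(1), of "(u - E) / 2"] \<open>E < u\<close> by auto
    \<comment> \<open>Positive, since \<open>t\<close> is obtained by dividing by it.\<close>
    define n where "n = Suc N"
    define \<eta> where "\<eta> = (\<Sum>i. h (i + Suc n))"
    have \<eta>: "\<eta> < (u - E) / 2" using N[of "Suc n"] by (simp add: \<eta>_def n_def)
    have "((\<lambda>s. E * (s powr (- \<gamma>)) ^ lc) \<longlongrightarrow> E * (1 powr (- \<gamma>)) ^ lc) (at_left 1)"
      by (intro tendsto_intros) auto
    then have "\<forall>\<^sub>F s in at_left 1. E * (s powr (- \<gamma>)) ^ lc < (u + E) / 2"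
      using \<open>E < u\<close> by (intro order_tendstoD(2)) auto
    moreover have "\<forall>\<^sub>F s in at_left (1::real). s \<in> {0<..<1}"
      by (rule eventually_at_left_real) simp
    ultimately have "\<forall>\<^sub>F s in at_left 1. E * (s powr (- \<gamma>)) ^ lc < (u + E) / 2 \<and> 0 < s \<and> s < 1"
      by eventually_elim auto
    then obtain s where s: "E * (s powr (- \<gamma>)) ^ lc < (u + E) / 2" "0 < s" "s < 1"
      using eventually_happens'[OF trivial_limit_at_left_real] by blast
    \<comment> \<open>Splits \<open>x\<close> into s x for the cut and n portions t x for the
      remaining edges.\<close>
    define t where "t = (1 - s) / real n"
    have t: "0 < t" "s + real n * t = 1" using s by (auto simp: t_def n_def)
    define b where "b = real (card (edge_box n) choose Suc lc)"
    \<comment> \<open>The middle term has one tail factor more than the normalisation, and this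
      leaves a factor \<open>survival D x\<close> that tends to 0.\<close>
    let ?U = "\<lambda>x. E * (survival D (s * x) / survival D x) ^ lc +
        b * (survival D (t * x) / survival D x) ^ Suc lc * survival D x + \<eta>"
    have "(?U \<longlongrightarrow> E * (s powr (- \<gamma>)) ^ lc + b * (t powr (- \<gamma>)) ^ Suc lc * 0 + \<eta>) at_top"
      using s t by (intro tendsto_intros survival_scale S0)
    then have "\<forall>\<^sub>F x in at_top. ?U x < u"
      using s(1) \<eta> by (intro order_tendstoD(2)) auto
    moreover have "\<forall>\<^sub>F x in at_top. a \<le> s * x"
      using eventually_ge_at_top[of "a / s"] by eventually_elim (use s in \<open>simp add: field_simps\<close>)
    moreover have "\<forall>\<^sub>F x in at_top. a \<le> t * x"
      using eventually_ge_at_top[of "a / t"] by eventually_elim (use t in \<open>simp add: field_simps\<close>)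
    ultimately show "\<forall>\<^sub>F x in at_top. ?P x / survival D x ^ lc < u"
    proof eventually_elim
      case (elim x)
      have x: "x = s * x + real n * (t * x)"
        using t(2) by (metis distrib_right mult.assoc mult_1)
      have "?P x \<le> (\<Sum>m<n. one_pivot_prob m) * survival D (s * x) ^ lc + b * survival D (t * x) ^ Suc lc
          + \<eta> * survival D x ^ lc"
        unfolding b_def \<eta>_def lc_def
        by (rule crossing_prob_le[OF h(1) h(2)[unfolded lc_def] elim(3,2) x])
      also have "(\<Sum>m<n. one_pivot_prob m) \<le> E"
        using sums one_pivot_prob_nonneg sum_le_suminf[of one_pivot_prob "{..<n}"]
        by (auto simp: sums_iff)
      finally have "?P x \<le> E * survival D (s * x) ^ lc + b * survival D (t * x) ^ Suc lc + \<eta> * survival D x ^ lc"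
        using survival_bounds[OF law] by (simp add: mult_right_mono)
      then have "?P x / survival D x ^ lc \<le> ?U x"
        using S[of x] by (simp add: field_simps)
      with elim(1) show ?case by simp
    qed
  }
qed

end

theorem lemma3p3:
  fixes M :: "'a measure"
    and W :: "int \<times> int \<Rightarrow> 'a \<Rightarrow> real"
    and D :: "real measure"
    and L :: "real \<Rightarrow> real"
    and l lc :: nat
    and a \<gamma> :: real
  assumes "l \<ge> 2"
    and "lc = l * (l + 1) div 2"
    and "real_distribution D"
    and "AE t in D. 0 \<le> t"
    and "0 < \<gamma>" and "\<gamma> < 2"
    and "slowly_varying L"
    and "\<forall>\<^sub>F x in at_top. survival D x = x powr (- \<gamma>) * L x"
    and "a > 0"
    and "measure D {2 * a<..} > 0"
    and "measure D {..<a} > 0"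
    and "prob_space M"
    and "prob_space.indep_vars M (\<lambda>_. borel) W (edges l)"
    and "\<And>e. e \<in> edges l \<Longrightarrow> distr M borel (W e) = D"
  defines "T \<equiv> \<lambda>\<omega>. passage_time l (\<lambda>e. W e \<omega>)"
    and "\<rho> \<equiv> \<lambda>\<omega>. rho l a (\<lambda>e. W e \<omega>)"
  shows "integrable M (\<lambda>\<omega>. real_of_int (\<rho> \<omega> 2 - \<rho> \<omega> 1)) \<and>
    ((\<lambda>x. survival D x powi (- int lc) *
          measure M {\<omega> \<in> space M. T \<omega> (\<rho> \<omega> 1) (\<rho> \<omega> 2) > ereal x})
      \<longlongrightarrow> prob_space.expectation M (\<lambda>\<omega>. real_of_int (\<rho> \<omega> 2 - \<rho> \<omega> 1))) at_top"
proof -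
  interpret spread_out_fpp_regular_tail M W D l a \<gamma> L
    using assms unfolding spread_out_fpp_regular_tail_def spread_out_fpp_def
      spread_out_fpp_axioms_def regular_tail_def by blast
  show ?thesis
    using expectation_gap(1) crossing_prob_limit
    by (simp add: T_def \<rho>_def first_pivot_def second_pivot_def assms(2) power_int_minus
        field_simps del: One_nat_def)
qed

end
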